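(* Consider the following online problem (online matching with reusable resources, OMR). There is a finite set $I$ of resources, each with a single unit of inventory and a reward $r_i\ge 0$, and a known usage duration $d>0$. Arrivals $t\in T$ come one at a time in an order chosen by an adversary, at nondecreasing times $a(t)$. When arrival $t$ occurs, the set of edges $(i,t)\in E$ incident to $t$ is revealed, and the algorithm must immediately and irrevocably either match $t$ to a neighbouring resource $i$ that is currently available, collecting reward $r_i$, or leave $t$ unmatched. A resource matched to $t$ is unavailable during the time interval $(a(t),a(t)+d]$ and is available again afterwards. The offline optimum $\mathrm{Offline}(G)$ of an instance $G=(I,T,E,(a(t))_{t\in T},(r_i)_{i\in I},d)$ is the maximum total reward of a feasible matching chosen with full knowledge of the instance. Consider the Periodic Reranking algorithm with parameter $\beta=0.89$, defined as follows. Let $g(x)=e^{\beta(x-1)}$. Time is partitioned into consecutive periods of length $d$. At the start of every period, the algorithm draws fresh seeds $y_i\sim U[0,1]$ for all $i\in I$, independently of each other and of all previous draws. Each arrival $t$ is matched to an available resource $i$ with $(i,t)\in E$ that maximizes $r_i(1-g(y_i))$, where $y_i$ is the current seed of $i$; if no neighbour of $t$ is available, $t$ is left unmatched. Then this algorithm is $0.589$-competitive: for every instance $G$, its expected total reward is at least $0.589\cdot \mathrm{Offline}(G)$. *)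

theory Defs
  imports "HOL-Probability.Probability"
begin

text \<open>Arrivals are indexed by \<open>0, \<dots>, num_arrivals - 1\<close> in the order in which they come.\<close>

record 'i omr =
  resources :: "'i set"
  num_arrivals :: nat
  edges :: "('i \<times> nat) set"
  arr_time :: "nat \<Rightarrow> real"
  reward :: "'i \<Rightarrow> real"
  duration :: real

definition omr_instance :: "'i omr \<Rightarrow> bool" where
  "omr_instance G \<longleftrightarrow>
     finite (resources G) \<and>
     edges G \<subseteq> resources G \<times> {..<num_arrivals G} \<and>
     mono_on {..<num_arrivals G} (arr_time G) \<and>
     (\<forall>i\<in>resources G. 0 \<le> reward G i) \<and>
     0 < duration G"

text \<open>
  \<open>M\<close> is the set of matches made before arrival \<open>t\<close>, so \<open>arr_time G s \<le> arr_time G t\<close> for all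
  \<open>(i, s) \<in> M\<close>. A match at \<open>s\<close> blocks the single unit of \<open>i\<close> up to and including time
  \<open>arr_time G s + duration G\<close>. In particular it blocks later arrivals at the same time as \<open>s\<close>.
\<close>

definition available :: "'i omr \<Rightarrow> ('i \<times> nat) set \<Rightarrow> nat \<Rightarrow> 'i \<Rightarrow> bool" where
  "available G M t i \<longleftrightarrow> (\<forall>s. (i, s) \<in> M \<longrightarrow> arr_time G s + duration G < arr_time G t)"

definition feasible_matching :: "'i omr \<Rightarrow> ('i \<times> nat) set \<Rightarrow> bool" where
  "feasible_matching G M \<longleftrightarrow>
     M \<subseteq> edges G \<and>
     (\<forall>i j t. (i, t) \<in> M \<and> (j, t) \<in> M \<longrightarrow> i = j) \<and>
     (\<forall>(i, t)\<in>M. available G {(j, s)\<in>M. s < t} t i)"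

definition total_reward :: "'i omr \<Rightarrow> ('i \<times> nat) set \<Rightarrow> real" where
  "total_reward G M = (\<Sum>(i, t)\<in>M. reward G i)"

definition Offline :: "'i omr \<Rightarrow> real" where
  "Offline G = Max (total_reward G ` {M. feasible_matching G M})"

definition g :: "real \<Rightarrow> real \<Rightarrow> real" where
  "g \<beta> x = exp (\<beta> * (x - 1))"

text \<open>Period \<open>k\<close> is the time interval \<open>[k d, (k + 1) d)\<close> for \<open>k :: int\<close>.\<close>

definition period :: "'i omr \<Rightarrow> nat \<Rightarrow> int" where
  "period G t = \<lfloor>arr_time G t / duration G\<rfloor>"

text \<open>\<open>y (k, i)\<close> is the seed of resource \<open>i\<close> drawn at the start of period \<open>k\<close>.\<close>

definition seeds :: "'i omr \<Rightarrow> (int \<times> 'i \<Rightarrow> real) measure" where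
  "seeds G = PiM (UNIV \<times> resources G) (\<lambda>_. uniform_measure lborel {0..1})"

text \<open>
  The matches made by Periodic Reranking on the first arrivals, where \<open>tie t S\<close> selects the
  resource for arrival \<open>t\<close> from the set \<open>S\<close> of maximizers.
\<close>

primrec periodic_reranking ::
  "real \<Rightarrow> (nat \<Rightarrow> 'i set \<Rightarrow> 'i) \<Rightarrow> 'i omr \<Rightarrow> (int \<times> 'i \<Rightarrow> real) \<Rightarrow> nat \<Rightarrow> ('i \<times> nat) set" where
  "periodic_reranking \<beta> tie G y 0 = {}"
| "periodic_reranking \<beta> tie G y (Suc t) =
     (let M = periodic_reranking \<beta> tie G y t;
          A = {i. (i, t) \<in> edges G \<and> available G M t i};
          S = {i. is_arg_max (\<lambda>i. reward G i * (1 - g \<beta> (y (period G t, i)))) (\<lambda>i. i \<in> A) i}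
      in if A = {} then M else insert (tie t S, t) M)"

definition expected_reward :: "real \<Rightarrow> (nat \<Rightarrow> 'i set \<Rightarrow> 'i) \<Rightarrow> 'i omr \<Rightarrow> real" where
  "expected_reward \<beta> tie G =
     (\<integral>y. total_reward G (periodic_reranking \<beta> tie G y (num_arrivals G)) \<partial>seeds G)"

end

theory Submission
  imports Defs
begin

text \<open>
  Fix an edge \<open>(i, t)\<close> of an optimal matching, with \<open>t\<close> in period \<open>k\<close>. A match of \<open>i\<close> with seed \<open>x\<close>
  pays \<open>r\<^sub>i (1 - g x)\<close> to the arrival and \<open>r\<^sub>i g x\<close> to at most one optimal edge \<open>(i, t)\<close>: either
  the one in the same period, if the match is not later than \<open>t\<close>, or the one in the next period, if
  the match still blocks \<open>i\<close> at \<open>t\<close>.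

  Fix all seeds except \<open>x\<close>, \<open>w\<close> of \<open>i\<close> in the periods \<open>k - 1\<close>, \<open>k\<close>. Let \<open>r\<^sub>i (1 - u)\<close> be what \<open>t\<close> is
  paid when \<open>i\<close> is removed from both periods. If \<open>i\<close> is not matched in period \<open>k - 1\<close>, then the
  usual analysis of ranking gives \<open>1 - u + (u - g 0) / \<beta>\<close> on average over \<open>w\<close>. If \<open>i\<close> is matched in
  period \<open>k - 1\<close> so late that it is blocked at \<open>t\<close>, then the other resources are no less available up
  to \<open>t\<close>, and the gain is at least \<open>1 - u + g x\<close>. If \<open>i\<close> is matched earlier in period \<open>k - 1\<close>, then
  the gain is at least \<open>1 - g 0\<close>, and this happens for an initial segment of the values of \<open>x\<close>. The
  worst case over \<open>u\<close> and over the segment is the smaller of \<open>1 - g 0\<close> and the integral of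
  \<open>min (g x) ((1 - g 0) / \<beta>)\<close>, which both exceed \<open>0.589\<close> for \<open>\<beta> = 0.89\<close>.
\<close>

section \<open>Resampling a coordinate of a product measure\<close>

text \<open>Overwriting coordinate \<open>j\<close> by an independent draw from \<open>M j\<close>
  leaves the product law unchanged, and Tonelli turns this into an iterated integral. It allows the
  seeds of one resource in two periods to be integrated first, with all other seeds fixed.\<close>

lemma nn_integral_PiM_resample:
  assumes M: "\<And>i. i \<in> I \<Longrightarrow> prob_space (M i)" and j: "j \<in> I"
    and f [measurable]: "f \<in> borel_measurable (PiM I M)"
  shows "(\<integral>\<^sup>+ y. f y \<partial>PiM I M) = (\<integral>\<^sup>+ y. (\<integral>\<^sup>+ x. f (y(j := x)) \<partial>M j) \<partial>PiM I M)"
    and "(\<lambda>y. \<integral>\<^sup>+ x. f (y(j := x)) \<partial>M j) \<in> borel_measurable (PiM I M)"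
proof -
  \<comment> \<open>The law of a product with one inserted coordinate is applied to an index already
    in \<open>I\<close>, whose old value is overwritten.\<close>
  have ins: "insert j I = I" using j by blast
  interpret J: prob_space "M j" using M j by blast
  interpret P: prob_space "PiM I M" using M by (intro prob_space_PiM) auto
  interpret JP: pair_sigma_finite "M j" "PiM I M" ..
  have upd [measurable]: "(\<lambda>(x, y). y(j := x)) \<in> measurable (M j \<Otimes>\<^sub>M PiM I M) (PiM I M)"
    using measurable_add_dim[of j I M] measurable_compose[OF measurable_pair_swap', of "\<lambda>(f, y). f(j := y)"]
    by (simp add: ins case_prod_beta')
  have "distr (M j \<Otimes>\<^sub>M PiM I M) (PiM I M) (\<lambda>(x, y). y(j := x)) = PiM I M"
    using distr_pair_PiM_eq_PiM[of I M j] M j by (simp add: ins)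
  then have "(\<integral>\<^sup>+ y. f y \<partial>PiM I M) =
      (\<integral>\<^sup>+ y. f y \<partial>distr (M j \<Otimes>\<^sub>M PiM I M) (PiM I M) (\<lambda>(x, y). y(j := x)))"
    by simp
  also have "\<dots> = (\<integral>\<^sup>+ (x, y). f (y(j := x)) \<partial>(M j \<Otimes>\<^sub>M PiM I M))"
    by (subst nn_integral_distr) (auto simp: case_prod_beta')
  also have "\<dots> = (\<integral>\<^sup>+ y. (\<integral>\<^sup>+ x. f (y(j := x)) \<partial>M j) \<partial>PiM I M)"
    by (subst JP.nn_integral_snd[symmetric]) auto
  finally show "(\<integral>\<^sup>+ y. f y \<partial>PiM I M) = (\<integral>\<^sup>+ y. (\<integral>\<^sup>+ x. f (y(j := x)) \<partial>M j) \<partial>PiM I M)" .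
  show "(\<lambda>y. \<integral>\<^sup>+ x. f (y(j := x)) \<partial>M j) \<in> borel_measurable (PiM I M)"
    by (intro J.borel_measurable_nn_integral) (use measurable_compose[OF measurable_pair_swap' measurable_compose[OF upd f]] in \<open>simp add: case_prod_beta'\<close>)
qed

text \<open>The exceptional set is null because, by resampling, its measure is an integral of
  sections that are all null.\<close>

lemma AE_PiM_resample:
  assumes M: "\<And>i. i \<in> I \<Longrightarrow> prob_space (M i)" and j: "j \<in> I"
    and P [measurable]: "Measurable.pred (PiM I M) P"
    and AE: "\<And>y. y \<in> space (PiM I M) \<Longrightarrow> AE x in M j. P (y(j := x))"
  shows "AE y in PiM I M. P y"
proof -
  let ?f = "\<lambda>y. if P y then 0 else 1 :: ennreal"
  have "(\<integral>\<^sup>+ y. ?f y \<partial>PiM I M) =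
      (\<integral>\<^sup>+ y. indicator {y \<in> space (PiM I M). \<not> P y} y \<partial>PiM I M)"
    by (intro nn_integral_cong) simp
  then have "emeasure (PiM I M) {y \<in> space (PiM I M). \<not> P y} = (\<integral>\<^sup>+ y. ?f y \<partial>PiM I M)"
    by simp
  also have "\<dots> = (\<integral>\<^sup>+ y. (\<integral>\<^sup>+ x. ?f (y(j := x)) \<partial>M j) \<partial>PiM I M)"
    by (intro nn_integral_PiM_resample M j) simp_all
  also have "\<dots> = (\<integral>\<^sup>+ y. 0 \<partial>PiM I M)"
  proof (intro nn_integral_cong)
    fix y assume "y \<in> space (PiM I M)"
    from AE[OF this] have "AE x in M j. ?f (y(j := x)) = 0"
      by eventually_elim simp
    then have "(\<integral>\<^sup>+ x. ?f (y(j := x)) \<partial>M j) = (\<integral>\<^sup>+ x. 0 \<partial>M j)"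
      by (rule nn_integral_cong_AE)
    then show "(\<integral>\<^sup>+ x. ?f (y(j := x)) \<partial>M j) = 0" by simp
  qed
  finally have "emeasure (PiM I M) {y \<in> space (PiM I M). \<not> P y} = 0" by simp
  then show ?thesis by (intro AE_I[where N = "{y \<in> space (PiM I M). \<not> P y}"]) auto
qed

text \<open>A random subset of a finite set takes finitely many values, so preimages of singletons
  suffice, and each is a finite conjunction of events.\<close>

lemma measurable_finite_Collect:
  assumes "finite R" "\<And>i. i \<in> R \<Longrightarrow> Measurable.pred N (P i)"
  shows "(\<lambda>y. {i \<in> R. P i y}) \<in> measurable N (count_space (Pow R))"
proof (subst measurable_count_space_eq2, use assms(1) in simp, intro conjI ballI)
  fix X assume "X \<in> Pow R"
  then have "(\<lambda>y. {i \<in> R. P i y}) -` {X} \<inter> space N = {y \<in> space N. \<forall>i\<in>R. P i y \<longleftrightarrow> i \<in> X}"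
    by auto
  also have "\<dots> \<in> sets N"
    using assms by (intro sets.sets_Collect_finite_All sets.sets_Collect) (auto simp: pred_def)
  finally show "(\<lambda>y. {i \<in> R. P i y}) -` {X} \<inter> space N \<in> sets N" .
qed auto

section \<open>Integrals over a uniform seed\<close>

abbreviation unif01 :: "real measure" where
  "unif01 \<equiv> uniform_measure lborel {0..1}"

lemma prob_space_unif01: "prob_space unif01"
  by (intro prob_space_uniform_measure) auto

lemma AE_unif01: "AE x in unif01. 0 \<le> x \<and> x < 1"
proof -
  have "AE x in lborel. x \<noteq> (1::real)" by (rule AE_lborel_singleton)
  then show ?thesis by (intro AE_uniform_measureI) (auto elim!: eventually_mono)
qed

lemma AE_unif01_not_eq: "AE x in unif01. x \<noteq> c"
  by (intro AE_uniform_measureI) (auto intro: eventually_mono[OF AE_lborel_singleton[of c]])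

lemma nn_integral_unif01:
  assumes [measurable]: "f \<in> borel_measurable borel"
  shows "(\<integral>\<^sup>+ x. f x \<partial>unif01) = (\<integral>\<^sup>+ x. f x * indicator {0..1} x \<partial>lborel)"
  by (subst nn_integral_uniform_measure) (auto simp: divide_ennreal_def)

lemma g_mono: "0 < \<beta> \<Longrightarrow> x \<le> y \<Longrightarrow> g \<beta> x \<le> g \<beta> y"
  and g_strict_mono: "0 < \<beta> \<Longrightarrow> x < y \<Longrightarrow> g \<beta> x < g \<beta> y"
  and g_pos: "0 < g \<beta> x"
  and g_one: "g \<beta> 1 = 1"
  by (auto simp: g_def)

lemma borel_measurable_g [measurable]: "g \<beta> \<in> borel_measurable borel"
  unfolding g_def[abs_def] by measurable

lemma nn_integral_g:
  assumes "0 < \<beta>" "0 \<le> p" "p \<le> 1"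
  shows "(\<integral>\<^sup>+ x. ennreal (g \<beta> x) * indicator {0..p} x \<partial>unif01) = ennreal ((g \<beta> p - g \<beta> 0) / \<beta>)"
proof -
  have "(\<integral>\<^sup>+ x. ennreal (g \<beta> x) * indicator {0..p} x \<partial>unif01) =
      (\<integral>\<^sup>+ x. ennreal (g \<beta> x) * indicator {0..p} x \<partial>lborel)"
    using assms by (subst nn_integral_unif01) (auto intro!: nn_integral_cong simp: indicator_def)
  also have "\<dots> = ennreal (g \<beta> p / \<beta> - g \<beta> 0 / \<beta>)"
  proof (rule nn_integral_FTC_Icc)
    show "((\<lambda>x. g \<beta> x / \<beta>) has_real_derivative g \<beta> x) (at x)" for x
      unfolding g_def using assms by (auto intro!: derivative_eq_intros)
  qed (use assms in \<open>auto simp: g_def\<close>)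
  finally show ?thesis by (simp add: diff_divide_distrib)
qed

text \<open>The condition \<open>g \<beta> x < u\<close> cuts off at the point \<open>z\<close> with
  \<open>g \<beta> z = u\<close>, and \<open>g \<beta> / \<beta>\<close> is an antiderivative of
  \<open>g \<beta>\<close>. This is the mean share contributed by the seeds that beat the threshold
  \<open>u\<close>.\<close>

lemma nn_integral_g_below:
  assumes "0 < \<beta>" "u \<le> 1"
  shows "ennreal ((u - g \<beta> 0) / \<beta>) \<le> (\<integral>\<^sup>+ x. ennreal (if g \<beta> x < u then g \<beta> x else 0) \<partial>unif01)"
proof (cases "u \<le> g \<beta> 0")
  \<comment> \<open>The left side is \<open>ennreal\<close> of a nonpositive number, hence
    0.\<close>
  case True
  then show ?thesis using assms by (simp add: ennreal_neg divide_nonpos_pos)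
next
  case False
  then have "0 < u" using g_pos[of \<beta> 0] by linarith
  define z where "z = 1 + ln u / \<beta>"
  have gz: "g \<beta> z = u" using \<open>0 < u\<close> assms by (simp add: g_def z_def)
  have z: "0 \<le> z" "z \<le> 1"
    using False gz g_strict_mono[OF assms(1), of z 0] assms \<open>0 < u\<close>
    by (auto simp: z_def divide_nonpos_pos not_less) (metis not_less z_def less_imp_le)
  have "ennreal ((u - g \<beta> 0) / \<beta>) = (\<integral>\<^sup>+ x. ennreal (g \<beta> x) * indicator {0..z} x \<partial>unif01)"
    using nn_integral_g[OF assms(1) z] gz by simp
  also have "\<dots> \<le> (\<integral>\<^sup>+ x. ennreal (if g \<beta> x < u then g \<beta> x else 0) \<partial>unif01)"
  proof (intro nn_integral_mono_AE)
    \<comment> \<open>The strict inequality fails at \<open>x = z\<close>, a null set.\<close>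
    show "AE x in unif01. ennreal (g \<beta> x) * indicator {0..z} x \<le> ennreal (if g \<beta> x < u then g \<beta> x else 0)"
      using AE_unif01_not_eq[of z]
    proof eventually_elim
      case (elim x)
      then show ?case
        using g_strict_mono[OF assms(1), of x z] gz by (cases "x \<in> {0..z}") auto
    qed
  qed
  finally show ?thesis .
qed

lemma nn_integral_unif01_const: "(\<integral>\<^sup>+ x. c \<partial>unif01) = c"
  using prob_space.emeasure_space_1[OF prob_space_unif01] by simp

text \<open>Here \<open>\<phi> x\<close> stands for the gain averaged over the seed \<open>w\<close>
  of period \<open>k\<close>, given the seed \<open>x\<close> of period \<open>k - 1\<close>. The
  threshold \<open>u\<close> belongs to the run without the resource in both periods, so it does not
  depend on \<open>x\<close>.\<close>

lemma gain_calculus: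
  assumes \<beta>: "0 < \<beta>" "\<beta> \<le> 1" and \<alpha>: "0 \<le> \<alpha>" "\<alpha> \<le> 1 - g \<beta> 0"
    and \<alpha>_int: "ennreal \<alpha> \<le> (\<integral>\<^sup>+ x. ennreal (min (g \<beta> x) ((1 - g \<beta> 0) / \<beta>)) \<partial>unif01)"
    and u: "u \<le> 1" and r: "0 \<le> r"
    and early: "\<And>x. 0 \<le> x \<Longrightarrow> x < 1 \<Longrightarrow> early x \<Longrightarrow> ennreal (r * (1 - g \<beta> 0)) \<le> \<phi> x"
    and late: "\<And>x. 0 \<le> x \<Longrightarrow> x < 1 \<Longrightarrow> \<not> early x \<Longrightarrow>
      ennreal (r * (1 - u + min (g \<beta> x) (max 0 ((u - g \<beta> 0) / \<beta>)))) \<le> \<phi> x"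
    and down: "\<And>x x'. early x \<Longrightarrow> x' < x \<Longrightarrow> early x'"
  shows "ennreal (r * \<alpha>) \<le> (\<integral>\<^sup>+ x. \<phi> x \<partial>unif01)"
proof -
  define h where "h x = 1 - u + min (g \<beta> x) (max 0 ((u - g \<beta> 0) / \<beta>))" for x
  have h_mono: "h x \<le> h x'" if "x \<le> x'" for x x'
    using g_mono[OF \<beta>(1) that] by (auto simp: h_def)
  have h_meas [measurable]: "h \<in> borel_measurable borel"
    unfolding h_def[abs_def] by measurable
  have g0: "g \<beta> 0 < 1" using g_strict_mono[OF \<beta>(1), of 0 1] by (simp add: g_one)
  have h_int: "ennreal \<alpha> \<le> (\<integral>\<^sup>+ x. ennreal (h x) \<partial>unif01)"
  proof (cases "u \<le> g \<beta> 0")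
    case True
    have "\<alpha> \<le> h x" for x
      using True \<alpha> g_pos[of \<beta> x] by (auto simp: h_def)
    then have "(\<integral>\<^sup>+ x. ennreal \<alpha> \<partial>unif01) \<le> (\<integral>\<^sup>+ x. ennreal (h x) \<partial>unif01)"
      by (intro nn_integral_mono ennreal_leI)
    then show ?thesis by (simp add: nn_integral_unif01_const)
  next
    case False
    define c where "c = (1 - g \<beta> 0) / \<beta>"
    \<comment> \<open>\<open>s\<close> is the position of \<open>u\<close> between
      \<open>g \<beta> 0\<close> and 1. On that interval \<open>h x\<close> is concave in
      \<open>u\<close>, so it lies above the chord between its end values
      \<open>1 - g \<beta> 0\<close> and \<open>min (g \<beta> x) c\<close>. The first is at least
      \<alpha>, and the second has integral at least \<alpha>.\<close>
    define s where "s = (u - g \<beta> 0) / (1 - g \<beta> 0)"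
    have s: "0 \<le> s" "s \<le> 1" using False u g0 by (auto simp: s_def)
    have su: "u - g \<beta> 0 = s * (1 - g \<beta> 0)" using g0 by (simp add: s_def)
    have c0: "0 \<le> c" using g0 \<beta> by (simp add: c_def)
    have lower: "(1 - s) * \<alpha> + s * min (g \<beta> x) c \<le> h x" for x
    proof -
      have "(1 - s) * \<alpha> \<le> (1 - s) * (1 - g \<beta> 0)" using s \<alpha> by (intro mult_left_mono) auto
      also have "\<dots> = 1 - u" using su by (simp add: algebra_simps)
      finally have 1: "(1 - s) * \<alpha> \<le> 1 - u" .
      have "(u - g \<beta> 0) / \<beta> = s * c" using su by (simp add: c_def)
      moreover have "s * min (g \<beta> x) c \<le> s * c" using s by (intro mult_left_mono) auto
      moreover have "s * min (g \<beta> x) c \<le> 1 * g \<beta> x"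
        using s c0 g_pos[of \<beta> x] by (intro mult_mono) auto
      ultimately have 2: "s * min (g \<beta> x) c \<le> min (g \<beta> x) (max 0 ((u - g \<beta> 0) / \<beta>))" by simp
      from 1 2 show ?thesis unfolding h_def by (rule add_mono)
    qed
    have "ennreal \<alpha> = ennreal ((1 - s) * \<alpha>) + ennreal s * ennreal \<alpha>"
    proof -
      have "\<alpha> = (1 - s) * \<alpha> + s * \<alpha>" by (simp add: algebra_simps)
      then have "ennreal \<alpha> = ennreal ((1 - s) * \<alpha> + s * \<alpha>)" by simp
      also have "\<dots> = ennreal ((1 - s) * \<alpha>) + ennreal s * ennreal \<alpha>"
        using s \<alpha> by (simp only: ennreal_plus ennreal_mult mult_nonneg_nonneg diff_ge_0_iff_ge)
      finally show ?thesis .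
    qed
    also have "\<dots> \<le> ennreal ((1 - s) * \<alpha>) + ennreal s * (\<integral>\<^sup>+ x. ennreal (min (g \<beta> x) c) \<partial>unif01)"
      using \<alpha>_int unfolding c_def by (intro add_left_mono mult_left_mono) auto
    also have "\<dots> = (\<integral>\<^sup>+ x. ennreal ((1 - s) * \<alpha>) + ennreal s * ennreal (min (g \<beta> x) c) \<partial>unif01)"
      by (simp add: nn_integral_add nn_integral_cmult nn_integral_unif01_const)
    also have "\<dots> = (\<integral>\<^sup>+ x. ennreal ((1 - s) * \<alpha> + s * min (g \<beta> x) c) \<partial>unif01)"
      using s \<alpha> c0 g_pos[of \<beta>]
      by (intro nn_integral_cong) (simp add: ennreal_mult[symmetric] ennreal_plus[symmetric] less_imp_le del: ennreal_plus)
    also have "\<dots> \<le> (\<integral>\<^sup>+ x. ennreal (h x) \<partial>unif01)"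
      using lower by (intro nn_integral_mono ennreal_leI)
    finally show ?thesis .
  qed
  \<comment> \<open>Since \<open>h\<close> is monotone and \<open>early\<close> an initial segment, either \<open>\<alpha>\<close> or \<open>h\<close> bounds the gain pointwise.\<close>
  show ?thesis
  proof (cases "\<forall>x. 0 \<le> x \<and> x < 1 \<and> \<not> early x \<longrightarrow> \<alpha> \<le> h x")
    case True
    have "(\<integral>\<^sup>+ x. ennreal (r * \<alpha>) \<partial>unif01) \<le> (\<integral>\<^sup>+ x. \<phi> x \<partial>unif01)"
    proof (rule nn_integral_mono_AE)
      show "AE x in unif01. ennreal (r * \<alpha>) \<le> \<phi> x"
        using AE_unif01
      proof eventually_elim
        case (elim x)
        show ?case
        proof (cases "early x")
          case e: True
          have "ennreal (r * \<alpha>) \<le> ennreal (r * (1 - g \<beta> 0))"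
            using \<alpha> r by (intro ennreal_leI mult_left_mono)
          then show ?thesis using early[of x] e elim by (auto intro: order_trans)
        next
          case e: False
          have "ennreal (r * \<alpha>) \<le> ennreal (r * h x)"
            using True e elim r by (intro ennreal_leI mult_left_mono) auto
          then show ?thesis using late[of x] e elim unfolding h_def by (auto intro: order_trans)
        qed
      qed
    qed
    then show ?thesis by (simp add: nn_integral_unif01_const)
  next
    case False
    then obtain x0 where x0: "\<not> early x0" "h x0 < \<alpha>" by (auto simp: not_le)
    have "ennreal (r * \<alpha>) \<le> ennreal r * (\<integral>\<^sup>+ x. ennreal (h x) \<partial>unif01)"
      using h_int r \<alpha> by (simp add: ennreal_mult mult_left_mono)
    also have "\<dots> = (\<integral>\<^sup>+ x. ennreal (r * h x) \<partial>unif01)"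
    proof -
      have "ennreal r * ennreal (h x) = ennreal (r * h x)" for x
        using r by (simp add: ennreal_mult')
      then show ?thesis by (subst nn_integral_cmult[symmetric]) auto
    qed
    also have "\<dots> \<le> (\<integral>\<^sup>+ x. \<phi> x \<partial>unif01)"
    proof (rule nn_integral_mono_AE)
      show "AE x in unif01. ennreal (r * h x) \<le> \<phi> x"
        using AE_unif01
      proof eventually_elim
        case (elim x)
        show ?case
        proof (cases "early x")
          case e: True
          \<comment> \<open>Beyond \<open>x0\<close> no seed is early, because \<open>early\<close>
            is closed downward and fails at \<open>x0\<close>.\<close>
          then have "x \<le> x0" using down[of x x0] x0 by force
          then have "h x \<le> 1 - g \<beta> 0" using h_mono[of x x0] x0 \<alpha> by simp
          then have "ennreal (r * h x) \<le> ennreal (r * (1 - g \<beta> 0))"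
            using r by (intro ennreal_leI mult_left_mono)
          then show ?thesis using early[of x] e elim by (auto intro: order_trans)
        next
          case False
          then show ?thesis using late[of x] elim unfolding h_def by auto
        qed
      qed
    qed
    finally show ?thesis .
  qed
qed

section \<open>Numerical bounds for \<beta> = 0.89\<close>

lemma exp_nonpos_Taylor:
  fixes x :: real
  assumes "x \<le> 0"
  shows "odd n \<Longrightarrow> exp x \<le> (\<Sum>m<n. x ^ m / fact m)"
    and "even n \<Longrightarrow> (\<Sum>m<n. x ^ m / fact m) \<le> exp x"
proof -
  obtain t where t: "exp x = (\<Sum>m<n. x ^ m / fact m) + exp t / fact n * x ^ n"
    using Maclaurin_exp_le by blast
  show "exp x \<le> (\<Sum>m<n. x ^ m / fact m)" if "odd n"
  proof -
    \<comment> \<open>The Lagrange remainder has the sign of \<open>x ^ n\<close>, so for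
      nonpositive \<open>x\<close> the parity of \<open>n\<close> decides on which side the partial
      sum lies.\<close>
    have "x ^ n \<le> 0" using that assms by (simp add: power_le_zero_eq odd_pos)
    then have "exp t / fact n * x ^ n \<le> 0" by (intro mult_nonneg_nonpos) simp_all
    with t show ?thesis by linarith
  qed
  show "(\<Sum>m<n. x ^ m / fact m) \<le> exp x" if "even n"
    using that t by (simp add: zero_le_even_power)
qed

lemma g_0_89_bounds:
  "g 0.89 0 \<le> 0.41066" "0.66168 \<le> g 0.89 0.536" "g 0.89 0.536 \<le> 0.6617"
proof -
  \<comment> \<open>The exponents are \<open>0.89 * (x - 1)\<close> at \<open>x = 0\<close> and at
    \<open>x = 0.536\<close>. Nine terms bound from above, eight from below.\<close>
  have "exp (-0.89::real) \<le> (\<Sum>m<9. (-0.89) ^ m / fact m)"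
    "(\<Sum>m<8. (-0.41296) ^ m / fact m) \<le> exp (-0.41296::real)"
    "exp (-0.41296::real) \<le> (\<Sum>m<9. (-0.41296) ^ m / fact m)"
    by (rule exp_nonpos_Taylor; simp)+
  then show "g 0.89 0 \<le> 0.41066" "0.66168 \<le> g 0.89 0.536" "g 0.89 0.536 \<le> 0.6617"
    by (simp_all add: g_def eval_nat_numeral)
qed

lemma emeasure_unif01_Ioc: "0 \<le> p \<Longrightarrow> p \<le> 1 \<Longrightarrow> emeasure unif01 {p<..1} = ennreal (1 - p)"
proof -
  assume "0 \<le> p" "p \<le> 1"
  then have "{0..1} \<inter> {p<..1} = {p<..1}" by auto
  with \<open>p \<le> 1\<close> show ?thesis by (simp add: divide_ennreal_def)
qed

text \<open>The integrand is bounded below by \<open>g\<close> up to \<open>p\<close> and by the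
  constant \<open>g p\<close> beyond \<open>p\<close>, which gives a closed form.\<close>

lemma ratio_integral_0_89:
  "ennreal 0.589 \<le> (\<integral>\<^sup>+ x. ennreal (min (g 0.89 x) ((1 - g 0.89 0) / 0.89)) \<partial>unif01)"
proof -
  \<comment> \<open>\<open>p\<close> is slightly below the point where \<open>g 0.89\<close> reaches \<open>(1 - g 0.89 0) / 0.89\<close>.\<close>
  define p :: real where "p = 0.536"
  let ?g = "g 0.89"
  have p: "0 \<le> p" "p \<le> 1" by (simp_all add: p_def)
  have gp: "?g p \<le> (1 - ?g 0) / 0.89" using g_0_89_bounds unfolding p_def by simp
  \<comment> \<open>With the bounds above the right side is at least 0.58906, a margin of about 6 /
    10^5.\<close>
  have "ennreal 0.589 \<le> ennreal ((?g p - ?g 0) / 0.89 + ?g p * (1 - p))"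
    using g_0_89_bounds unfolding p_def by (intro ennreal_leI) (simp add: field_simps)
  also have "\<dots> = ennreal ((?g p - ?g 0) / 0.89) + ennreal (?g p) * ennreal (1 - p)"
    using p g_mono[of "0.89" 0 p] g_pos[of "0.89" p] by (simp add: ennreal_mult ennreal_plus)
  also have "\<dots> = (\<integral>\<^sup>+ x. ennreal (?g x) * indicator {0..p} x \<partial>unif01) +
      (\<integral>\<^sup>+ x. ennreal (?g p) * indicator {p<..1} x \<partial>unif01)"
    using nn_integral_g[of "0.89" p] p by (simp add: nn_integral_cmult_indicator emeasure_unif01_Ioc del: emeasure_uniform_measure)
  also have "\<dots> = (\<integral>\<^sup>+ x. ennreal (?g x) * indicator {0..p} x + ennreal (?g p) * indicator {p<..1} x \<partial>unif01)"
    by (intro nn_integral_add[symmetric]) auto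
  also have "\<dots> \<le> (\<integral>\<^sup>+ x. ennreal (min (?g x) ((1 - ?g 0) / 0.89)) \<partial>unif01)"
  proof (rule nn_integral_mono)
    fix x
    have "x \<le> p \<Longrightarrow> ?g x \<le> ?g p" "p \<le> x \<Longrightarrow> ?g p \<le> ?g x" by (auto intro: g_mono)
    with gp show "ennreal (?g x) * indicator {0..p} x + ennreal (?g p) * indicator {p<..1} x
        \<le> ennreal (min (?g x) ((1 - ?g 0) / 0.89))"
      by (cases "x \<le> p") (auto simp: indicator_def intro!: ennreal_leI)
  qed
  finally show ?thesis .
qed

section \<open>The reranking run without ties and without worthless resources\<close>

locale reranking =
  fixes G :: "'i omr" and \<beta> :: real and rk :: "'i \<Rightarrow> nat"
  assumes inst: "omr_instance G" and beta_pos: "0 < \<beta>" and inj_rk: "inj_on rk (resources G)"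
begin

definition val :: "(int \<times> 'i \<Rightarrow> real) \<Rightarrow> nat \<Rightarrow> 'i \<Rightarrow> real" where
  "val y t i = reward G i * (1 - g \<beta> (y (period G t, i)))"

definition cand :: "(int \<times> 'i \<Rightarrow> real) \<Rightarrow> ('i \<times> nat) set \<Rightarrow> nat \<Rightarrow> 'i set" where
  "cand y M t = {i. (i, t) \<in> edges G \<and> available G M t i \<and> 0 < val y t i}"

definition best :: "('i \<Rightarrow> real) \<Rightarrow> 'i set \<Rightarrow> 'i \<Rightarrow> bool" where
  "best f A i \<longleftrightarrow> i \<in> A \<and> (\<forall>j\<in>A. f j < f i \<or> (f j = f i \<and> rk i \<le> rk j))"

text \<open>
  Only candidates of positive value are matched, so that setting a seed to \<open>1\<close> removes the resource
  from that period. The ranking \<open>rk\<close> breaks ties consistently, which makes the comparisons of runs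
  below valid for all seeds and not only for almost all of them.
\<close>

primrec run :: "(int \<times> 'i \<Rightarrow> real) \<Rightarrow> nat \<Rightarrow> ('i \<times> nat) set" where
  "run y 0 = {}"
| "run y (Suc t) = run y t \<union> {i. best (val y t) (cand y (run y t) t) i} \<times> {t}"

abbreviation cands :: "(int \<times> 'i \<Rightarrow> real) \<Rightarrow> nat \<Rightarrow> 'i set" where
  "cands y t \<equiv> cand y (run y t) t"

abbreviation matched :: "(int \<times> 'i \<Rightarrow> real) \<Rightarrow> nat \<Rightarrow> 'i \<Rightarrow> bool" where
  "matched y t i \<equiv> best (val y t) (cands y t) i"

text \<open>What arrival \<open>t\<close> is paid: the value of its match, or \<open>0\<close>.\<close>

definition lam :: "(int \<times> 'i \<Rightarrow> real) \<Rightarrow> nat \<Rightarrow> real" where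
  "lam y t = Max (insert 0 (val y t ` cands y t))"

section \<open>Periods and the reach of a match\<close>

lemma finite_resources: "finite (resources G)"
  and edge_resource: "(i, t) \<in> edges G \<Longrightarrow> i \<in> resources G"
  and edge_arrival: "(i, t) \<in> edges G \<Longrightarrow> t < num_arrivals G"
  and arr_time_mono: "s \<le> t \<Longrightarrow> t < num_arrivals G \<Longrightarrow> arr_time G s \<le> arr_time G t"
  and reward_nonneg: "i \<in> resources G \<Longrightarrow> 0 \<le> reward G i"
  and duration_pos: "0 < duration G"
  using inst by (auto simp: omr_instance_def mono_on_def)

lemma period_mono: "s \<le> t \<Longrightarrow> t < num_arrivals G \<Longrightarrow> period G s \<le> period G t"
  unfolding period_def using arr_time_mono duration_pos
  by (intro floor_mono divide_right_mono) auto

lemma period_bounds: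
  "of_int (period G t) * duration G \<le> arr_time G t"
  "arr_time G t < (of_int (period G t) + 1) * duration G"
proof -
  have "of_int (period G t) \<le> arr_time G t / duration G"
    "arr_time G t / duration G < of_int (period G t) + 1"
    unfolding period_def by linarith+
  then show "of_int (period G t) * duration G \<le> arr_time G t"
    "arr_time G t < (of_int (period G t) + 1) * duration G"
    using duration_pos by (auto simp: pos_le_divide_eq pos_divide_less_eq)
qed

text \<open>Periods are half-open intervals of length \<open>d\<close>, so a match blocks its
  resource for the rest of its own period.\<close>

lemma same_period_close:
  assumes "period G s = period G t"
  shows "arr_time G t < arr_time G s + duration G"
  using period_bounds(1)[of s] period_bounds(2)[of t] assms by (simp add: algebra_simps)

text \<open>A match in period \<open>k\<close> comes strictly before \<open>(k + 1) d\<close>, so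
  its block ends strictly before \<open>(k + 2) d\<close>.\<close>

lemma blocks_next_period_only:
  assumes "arr_time G t \<le> arr_time G s + duration G"
  shows "period G t \<le> period G s + 1"
proof -
  have "of_int (period G t) * duration G < (of_int (period G s) + 2) * duration G"
    using assms period_bounds(1)[of t] period_bounds(2)[of s] by (simp add: algebra_simps)
  then have "(of_int (period G t) :: real) < of_int (period G s) + 2"
    using duration_pos by (simp add: mult_less_cancel_right)
  then show ?thesis by linarith
qed

section \<open>Existence and uniqueness of the match of an arrival\<close>

lemma cand_subset: "cand y M t \<subseteq> resources G"
  by (auto simp: cand_def edge_resource)

lemma finite_cand: "finite (cand y M t)"
  using finite_subset[OF cand_subset finite_resources] .

lemma best_unique: "best f A i \<Longrightarrow> best f A j \<Longrightarrow> A \<subseteq> resources G \<Longrightarrow> i = j"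
  using inj_rk unfolding best_def inj_on_def by (metis subsetD order_antisym less_asym less_irrefl)

lemma best_exists:
  assumes "finite A" "A \<noteq> {}"
  shows "\<exists>i. best f A i"
proof -
  let ?B = "{i\<in>A. f i = Max (f ` A)}"
  have "Max (f ` A) \<in> f ` A" using assms by (intro Max_in) auto
  then have "?B \<noteq> {}" by auto
  then obtain i where i: "i \<in> ?B" "\<And>j. j \<in> ?B \<Longrightarrow> rk i \<le> rk j"
    using ex_has_least_nat[of "\<lambda>i. i \<in> ?B" _ rk] by blast
  have "f j \<le> f i" if "j \<in> A" for j
    using i(1) that assms by auto
  then have "best f A i"
    unfolding best_def using i by force
  then show ?thesis ..
qed

lemma best_subset:
  assumes "best f A i" "i \<in> B" "B \<subseteq> A" "\<And>j. j \<in> B \<Longrightarrow> f' j = f j"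
  shows "best f' B i"
  using assms unfolding best_def by (metis subsetD)

lemma mem_run: "(i, s) \<in> run y t \<longleftrightarrow> s < t \<and> matched y s i"
  by (induction t) (auto simp: less_Suc_eq)

lemma matched_cand: "matched y t i \<Longrightarrow> i \<in> cands y t"
  by (simp add: best_def)

lemma matched_exists: "cands y t \<noteq> {} \<Longrightarrow> \<exists>i. matched y t i"
  by (rule best_exists[OF finite_cand])

lemma matched_unique: "matched y t i \<Longrightarrow> matched y t j \<Longrightarrow> i = j"
  by (rule best_unique[OF _ _ cand_subset])

lemma matched_arrival: "matched y t i \<Longrightarrow> t < num_arrivals G"
  by (drule matched_cand) (auto simp: cand_def intro: edge_arrival)

lemma matched_gap:
  assumes "matched y s i" "matched y t i" "s < t"
  shows "arr_time G s + duration G < arr_time G t"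
proof -
  have "available G (run y t) t i" using matched_cand[OF assms(2)] by (simp add: cand_def)
  moreover have "(i, s) \<in> run y t" using assms mem_run by blast
  ultimately show ?thesis unfolding available_def by blast
qed

lemma matched_once_per_period:
  assumes "matched y s i" "matched y t i" "period G s = period G t"
  shows "s = t"
proof (cases s t rule: linorder_cases)
  case less
  then show ?thesis using matched_gap[OF assms(1,2)] same_period_close[OF assms(3)] by simp
next
  case greater
  then show ?thesis
    using matched_gap[OF assms(2,1)] same_period_close[OF assms(3)[symmetric]] by simp
qed simp

lemma not_available_iff:
  "\<not> available G (run y t) t i \<longleftrightarrow>
    (\<exists>s<t. matched y s i \<and> arr_time G t \<le> arr_time G s + duration G)"
  by (auto simp: available_def mem_run not_less)

section \<open>Removing a resource from one period\<close>

lemma val_removed [simp]: "period G t = k \<Longrightarrow> val (y((k, i) := 1)) t i = 0"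
  by (simp add: val_def g_def)

lemma val_upd_other: "period G t \<noteq> k \<or> j \<noteq> i \<Longrightarrow> val (y((k, i) := x)) t j = val y t j"
  by (auto simp: val_def)

text \<open>Seed 1 gives value 0, so within the period exactly \<open>i\<close> leaves the
  candidates. A winner other than \<open>i\<close> stays the winner because ties are broken
  consistently.\<close>

lemma matched_remove_step:
  assumes "run (y((k, i) := 1)) t = run y t" "\<not> (period G t = k \<and> matched y t i)"
  shows "matched (y((k, i) := 1)) t = matched y t"
proof (cases "period G t = k")
  case False
  then have "val (y((k, i) := 1)) t = val y t"
    by (auto simp: val_upd_other)
  with assms(1) show ?thesis by (simp add: cand_def)
next
  case True
  let ?y = "y((k, i) := 1)"
  have C: "cands ?y t = cands y t - {i}"
  proof (intro set_eqI)
    fix j show "j \<in> cands ?y t \<longleftrightarrow> j \<in> cands y t - {i}"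
      using True assms(1) by (cases "j = i") (simp_all add: cand_def val_upd_other)
  qed
  have *: "matched ?y t j" if "matched y t j" for j
  proof (rule best_subset[OF that])
    show "j \<in> cands ?y t" unfolding C using matched_cand[OF that] that assms(2) True by blast
    show "cands ?y t \<subseteq> cands y t" unfolding C by blast
    show "val ?y t l = val y t l" if "l \<in> cands ?y t" for l
      using that unfolding C by (simp add: val_upd_other)
  qed
  show ?thesis
  proof (intro ext iffI)
    fix j assume j: "matched ?y t j"
    have "cands y t \<noteq> {}" using matched_cand[OF j] unfolding C by blast
    then obtain j' where "matched y t j'" using matched_exists by blast
    with *[OF this] matched_unique[OF j] show "matched y t j" by blast
  qed (rule *)
qed

text \<open>Runs that differ in a single seed are compared through the run with that seed set to 1:
  each of them agrees with it as long as it leaves \<open>i\<close> unmatched in that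
  period.\<close>

lemma run_remove:
  assumes "\<And>s. s < t \<Longrightarrow> period G s = k \<Longrightarrow> \<not> matched y s i"
  shows "run (y((k, i) := 1)) t = run y t"
  using assms
proof (induction t)
  case (Suc t)
  have r: "run (y((k, i) := 1)) t = run y t" by (rule Suc.IH) (use Suc.prems in simp)
  have "matched (y((k, i) := 1)) t = matched y t"
    by (rule matched_remove_step[OF r]) (use Suc.prems in simp)
  then show ?case by (simp only: run.simps r)
qed simp

lemma run_upd_later:
  assumes "\<And>s. s < t \<Longrightarrow> period G s \<noteq> k"
  shows "run (y((k, i) := x)) t = run y t"
proof -
  have "run ((y((k, i) := x))((k, i) := 1)) t = run (y((k, i) := x)) t"
    "run (y((k, i) := 1)) t = run y t"
    by (rule run_remove; use assms in blast)+
  then show ?thesis by simp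
qed

lemma matched_upd_later:
  assumes "period G t < k" "t < num_arrivals G"
  shows "matched (y((k, i) := x)) t = matched y t"
proof -
  have "run (y((k, i) := x)) t = run y t"
    using assms period_mono[of _ t] by (intro run_upd_later) (metis less_imp_le not_less)
  moreover have "val (y((k, i) := x)) t = val y t"
    using assms by (auto simp: val_upd_other)
  ultimately show ?thesis by (simp add: cand_def)
qed

text \<open>This is the part of unavailability inherited from periods before \<open>k\<close>. Once
  the seeds of period \<open>k\<close> are fixed, it is the only influence of the past on that
  period, which makes it the interface for comparing two runs period by period.\<close>

definition blocked :: "(int \<times> 'i \<Rightarrow> real) \<Rightarrow> int \<Rightarrow> 'i \<Rightarrow> nat \<Rightarrow> bool" where
  "blocked y k j t \<longleftrightarrow>
    (\<exists>s. period G s < k \<and> matched y s j \<and> arr_time G t \<le> arr_time G s + duration G)"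

lemma blocked_imp_not_available:
  assumes "blocked y (period G t) j t" "t < num_arrivals G"
  shows "\<not> available G (run y t) t j"
proof -
  obtain s where s: "period G s < period G t" "matched y s j"
      "arr_time G t \<le> arr_time G s + duration G"
    using assms(1) by (auto simp: blocked_def)
  then have "s < t" using period_mono[of t s] matched_arrival[of y s j] by (meson not_less order.strict_iff_not)
  with s show ?thesis unfolding not_available_iff by blast
qed

lemma not_available_cases:
  assumes "\<not> available G (run y t) t j" "t < num_arrivals G"
  obtains "blocked y (period G t) j t"
    | s where "s < t" "period G s = period G t" "matched y s j"
proof -
  obtain s where s: "s < t" "matched y s j" "arr_time G t \<le> arr_time G s + duration G"
    using assms(1) unfolding not_available_iff by blast
  have "period G s \<le> period G t" using period_mono s assms by simp
  then consider "period G s < period G t" | "period G s = period G t" by linarith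
  then show thesis
  proof cases
    case 1
    then show ?thesis using s that(1) unfolding blocked_def by blast
  next
    case 2
    then show ?thesis using s that(2) by blast
  qed
qed

lemma blocked_cong:
  assumes "\<And>s. period G s < k \<Longrightarrow> s < num_arrivals G \<Longrightarrow> matched y s = matched y' s"
  shows "blocked y k j t = blocked y' k j t"
proof -
  have "matched y s j \<longleftrightarrow> matched y' s j" if "period G s < k" for s
    using assms[OF that] matched_arrival[of y s j] matched_arrival[of y' s j] by auto
  then show ?thesis unfolding blocked_def by blast
qed

text \<open>
  The last assumption: a resource that is blocked only in the second run stays blocked there up to
  \<open>T\<close>. Without it, the first run could use up such a resource before it returns in the second run.
\<close>

lemma cands_mono:
  assumes y2: "y2 (k, i) = 1"
    and agree: "\<And>j. j \<noteq> i \<Longrightarrow> y1 (k, j) = y2 (k, j)"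
    and a: "\<And>j t. j \<noteq> i \<Longrightarrow> t \<le> T \<Longrightarrow> period G t = k \<Longrightarrow> blocked y1 k j t \<Longrightarrow> blocked y2 k j t"
    and b: "\<And>j s t. j \<noteq> i \<Longrightarrow> s \<le> t \<Longrightarrow> t \<le> T \<Longrightarrow> period G s = k \<Longrightarrow> period G t = k \<Longrightarrow>
      blocked y2 k j s \<Longrightarrow> blocked y1 k j s \<or> blocked y2 k j t"
    and T: "T < num_arrivals G"
  shows "t \<le> T \<Longrightarrow> period G t = k \<Longrightarrow> cands y2 t \<subseteq> cands y1 t"
proof (induction t rule: less_induct)
  case (less t)
  have val_eq: "val y1 s j = val y2 s j" if "period G s = k" "j \<noteq> i" for s j
    using agree that by (simp add: val_def)
  have not_i: "i \<notin> cands y2 s" if "period G s = k" for s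
    using y2 that by (simp add: cand_def val_def g_def)
  show ?case
  proof
    fix j assume j: "j \<in> cands y2 t"
    then have "j \<noteq> i" using not_i[of t] less.prems by blast
    have av2: "available G (run y2 t) t j" using j by (simp add: cand_def)
    have "available G (run y1 t) t j"
    proof (rule ccontr)
      assume "\<not> available G (run y1 t) t j"
      moreover have tn: "t < num_arrivals G" using less T by simp
      ultimately show False
      proof (cases rule: not_available_cases)
        case 1
        then have "blocked y2 (period G t) j t" using a[of j t] \<open>j \<noteq> i\<close> less by simp
        then show False using blocked_imp_not_available[of y2 t j] tn av2 by blast
      next
        case (2 s)
        have sn: "s < num_arrivals G" using 2 tn by simp
        have "arr_time G t \<le> arr_time G s + duration G"
          using same_period_close[of s t] 2 by simp
        then have "\<not> matched y2 s j" using av2 2 not_available_iff[of y2 t j] by blast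
        have sub: "cands y2 s \<subseteq> cands y1 s" using less 2 by simp
        have j1: "j \<in> cands y1 s" using matched_cand[OF 2(3)] .
        have "j \<notin> cands y2 s"
        proof
          assume "j \<in> cands y2 s"
          moreover have "val y2 s l = val y1 s l" if "l \<in> cands y2 s" for l
          proof -
            have "period G s = k" using 2 less by simp
            then show ?thesis using val_eq[of s l] not_i[of s] that by (cases "l = i") simp_all
          qed
          ultimately have "matched y2 s j" by (rule best_subset[OF 2(3) _ sub])
          then show False using \<open>\<not> matched y2 s j\<close> by blast
        qed
        then have "\<not> available G (run y2 s) s j"
          using j1 val_eq[of s j] \<open>j \<noteq> i\<close> 2 less by (auto simp: cand_def)
        then show False using sn
        proof (cases rule: not_available_cases)
          case 1
          \<comment> \<open>This is where the last assumption is needed: the block of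
            \<open>j\<close> in the second run could otherwise end between \<open>s\<close> and
            \<open>t\<close>.\<close>
          then have "blocked y1 k j s \<or> blocked y2 k j t"
            using b[of j s t] \<open>j \<noteq> i\<close> 2 less by simp
          moreover have "\<not> blocked y1 k j s"
            using blocked_imp_not_available[of y1 s j] j1 sn 2 less by (auto simp: cand_def)
          moreover have "\<not> blocked y2 k j t"
            using blocked_imp_not_available[of y2 t j] av2 tn less by auto
          ultimately show False by blast
        next
          case (2 s')
          have "s' < t" "period G s' = period G t" using 2 \<open>s < t\<close> \<open>period G s = period G t\<close> by auto
          then show False
            using av2 not_available_iff[of y2 t j] same_period_close[of s' t] 2 by auto
        qed
      qed
    qed
    then show "j \<in> cands y1 t"
      using j val_eq[of t j] less \<open>j \<noteq> i\<close> by (auto simp: cand_def)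
  qed
qed

section \<open>Payments to arrivals when a resource is removed\<close>

lemma lam_mono:
  assumes "cands y2 t \<subseteq> cands y1 t" "\<And>j. j \<in> cands y2 t \<Longrightarrow> val y1 t j = val y2 t j"
  shows "lam y2 t \<le> lam y1 t"
proof -
  have "val y2 t ` cands y2 t \<subseteq> val y1 t ` cands y1 t" using assms by force
  then show ?thesis unfolding lam_def using finite_cand by (intro Max_mono) auto
qed

lemma lam_nonneg: "0 \<le> lam y t"
  unfolding lam_def using finite_cand by (intro Max_ge) auto

lemma val_le_lam: "i \<in> cands y t \<Longrightarrow> val y t i \<le> lam y t"
  unfolding lam_def using finite_cand by (intro Max_ge) auto

lemma lam_matched:
  assumes "matched y t i" shows "lam y t = val y t i"
  unfolding lam_def
proof (rule Max_eqI)
  show "finite (insert 0 (val y t ` cands y t))" using finite_cand by auto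
  show "val y t i \<in> insert 0 (val y t ` cands y t)" using matched_cand assms by blast
  show "v \<le> val y t i" if "v \<in> insert 0 (val y t ` cands y t)" for v
    using that assms by (fastforce simp: best_def cand_def)
qed

lemma lam_unmatched:
  assumes "\<And>i. \<not> matched y t i" shows "lam y t = 0"
proof -
  have "cands y t = {}" using matched_exists assms by blast
  then show ?thesis by (simp add: lam_def)
qed

text \<open>Earlier periods do not see the change, so both runs enter period \<open>k\<close> with
  the same blocked resources, and both assumptions of \<open>cands_mono\<close> on blocking are
  immediate.\<close>

lemma lam_remove_le:
  assumes "t < num_arrivals G" "period G t = k"
  shows "lam (y((k, i) := 1)) t \<le> lam y t"
proof -
  let ?y = "y((k, i) := 1)"
  have bl: "blocked y k j s = blocked ?y k j s" for j s
    by (rule blocked_cong) (simp add: matched_upd_later)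
  have "cands ?y t \<subseteq> cands y t"
    using bl assms by (intro cands_mono[where k = k and i = i and T = t]) auto
  moreover have "i \<notin> cands ?y t" using assms by (simp add: cand_def)
  ultimately show ?thesis
  proof (intro lam_mono)
    show "val y t j = val ?y t j" if "j \<in> cands ?y t" for j
      using that \<open>i \<notin> cands ?y t\<close> val_upd_other[of t k j i y 1] by (cases "j = i") simp_all
  qed
qed

text \<open>The dominance property of ranking. If \<open>i\<close> were unmatched up to and
  including \<open>t\<close>, it would be a candidate at \<open>t\<close>, and removing it would
  change nothing. The match of \<open>t\<close> would then be worth at least
  \<open>val y t i\<close> also in the run without \<open>i\<close>.\<close>

lemma matched_if_val_large:
  assumes t: "t < num_arrivals G" "period G t = k" and edge: "(i, t) \<in> edges G"
    and "\<not> blocked y k i t"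
    and large: "lam (y((k, i) := 1)) t < val y t i"
  shows "\<exists>s\<le>t. period G s = k \<and> matched y s i"
proof (rule ccontr)
  assume *: "\<not> ?thesis"
  have av: "available G (run y t) t i"
  proof (rule ccontr)
    assume "\<not> ?thesis"
    then show False using t(1)
      by (rule not_available_cases) (use * assms in \<open>auto intro: less_imp_le\<close>)
  qed
  have "0 < val y t i" using lam_nonneg large by (rule le_less_trans)
  then have i: "i \<in> cands y t" using av edge by (simp add: cand_def)
  then obtain j where j: "matched y t j" using matched_exists by blast
  have "j \<noteq> i" using * j t by blast
  have "run (y((k, i) := 1)) t = run y t" by (rule run_remove) (use * in auto)
  then have "matched (y((k, i) := 1)) t j"
    using matched_remove_step[of y k i t] * j by auto
  then have "lam (y((k, i) := 1)) t = val y t j"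
    using lam_matched[of "y((k, i) := 1)" t j] val_upd_other[of t k j i y 1] \<open>j \<noteq> i\<close> by simp
  also have "val y t i \<le> \<dots>" using val_le_lam[OF i] lam_matched[OF j] by simp
  finally show False using large by simp
qed

text \<open>As long as \<open>i\<close> is unmatched in the period, both runs agree with the run
  without it. At \<open>s\<close> the smaller seed only raises the value of \<open>i\<close>, so
  \<open>i\<close> wins there unless matched before.\<close>

lemma matched_downward:
  assumes "matched (y((k, i) := x)) s i" "period G s = k" "x' < x"
  shows "\<exists>s'\<le>s. period G s' = k \<and> matched (y((k, i) := x')) s' i"
proof (rule ccontr)
  assume *: "\<not> ?thesis"
  let ?y = "y((k, i) := x)" and ?y' = "y((k, i) := x')"
  have "run (?y((k, i) := 1)) s = run ?y s"
  proof (rule run_remove)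
    show "\<not> matched ?y s' i" if "s' < s" "period G s' = k" for s'
      using matched_once_per_period[OF _ assms(1), of s'] assms(2) that by auto
  qed
  moreover have "run (?y'((k, i) := 1)) s = run ?y' s"
    by (rule run_remove) (use * in auto)
  ultimately have r: "run ?y' s = run ?y s" by simp
  have i: "i \<in> cands ?y s" by (rule matched_cand[OF assms(1)])
  then have "0 \<le> reward G i" and val_pos: "0 < val ?y s i"
    using reward_nonneg[of i] cand_subset[of ?y "run ?y s" s] by (blast, simp add: cand_def)
  \<comment> \<open>Candidates have positive value, which makes the reward positive and the value
    strictly decreasing in the seed.\<close>
  then have pos: "0 < reward G i"
    by (auto simp: val_def zero_less_mult_iff)
  have less: "val ?y s i < val ?y' s i"
    using assms beta_pos pos by (simp add: val_def g_def)
  have val_other: "val ?y' s j = val ?y s j" if "j \<noteq> i" for j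
    using that by (simp add: val_upd_other)
  have C: "cands ?y' s = cands ?y s"
  proof (intro set_eqI)
    fix j show "j \<in> cands ?y' s \<longleftrightarrow> j \<in> cands ?y s"
      using less val_pos r by (cases "j = i") (simp_all add: cand_def val_other)
  qed
  have "val ?y' s j < val ?y' s i \<or> (val ?y' s j = val ?y' s i \<and> rk i \<le> rk j)"
    if "j \<in> cands ?y s" for j
  proof (cases "j = i")
    case False
    have "val ?y s j \<le> val ?y s i" using assms(1) that unfolding best_def by fastforce
    then show ?thesis using less val_other[OF False] by linarith
  qed simp
  then have "matched ?y' s i"
    unfolding best_def C using i by blast
  then show False using * assms by blast
qed

text \<open>Both runs coincide before \<open>s0\<close>, and every match from \<open>s0\<close> on
  still blocks at \<open>T\<close>, since the one at \<open>s0\<close> does. Among the other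
  resources, the run that uses \<open>i\<close> in period \<open>k - 1\<close> consumes no more than
  the run without it. Hence whatever it finds blocked in period \<open>k\<close> up to
  \<open>T\<close> is blocked in the other run too.\<close>

lemma lam_ge_removed_if_blocked:
  assumes T: "T < num_arrivals G" "period G T = k"
    and y2: "y2 = y1((k - 1, i) := 1)" and y1: "y1 (k, i) = 1"
    and s0: "period G s0 < k" "matched y1 s0 i" "arr_time G T \<le> arr_time G s0 + duration G"
  shows "lam y2 T \<le> lam y1 T"
proof -
  have ps0: "period G s0 = k - 1" using blocks_next_period_only[OF s0(3)] s0 T by simp
  have not_i: "\<not> matched y1 s i" if "s < s0" "period G s = k - 1" for s
    using matched_once_per_period[of y1 s i s0] s0 ps0 that by auto
  have same: "matched y2 s = matched y1 s" if "s < s0" for s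
    unfolding y2 using not_i that by (intro matched_remove_step run_remove) auto
  have bl: "blocked y1 (k - 1) j t = blocked y2 (k - 1) j t" for j t
    unfolding y2 by (rule blocked_cong) (simp add: matched_upd_later)
  \<comment> \<open>A resource taken by the first run is taken by the second run in the same period,
    possibly at another arrival: if still available at \<open>s\<close>, it wins against fewer
    candidates; if not, it was matched earlier in the period, as inherited blocking agrees.\<close>
  have prev: "\<exists>s'. period G s' = k - 1 \<and> matched y2 s' j"
    if s: "period G s = k - 1" "matched y1 s j" and "j \<noteq> i" for s j
  proof (cases "available G (run y2 s) s j")
    case True
    have sn: "s < num_arrivals G" using matched_arrival s by blast
    have sub: "cands y2 s \<subseteq> cands y1 s"
      using bl s sn y2 by (intro cands_mono[where k = "k - 1" and i = i and T = s]) auto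
    have "j \<in> cands y2 s"
      using True matched_cand[OF s(2)] val_upd_other[of s "k - 1" j i y1 1] \<open>j \<noteq> i\<close>
      by (auto simp: cand_def y2)
    moreover have "val y2 s l = val y1 s l" if "l \<in> cands y2 s" for l
    proof -
      have "l \<noteq> i" using that s by (auto simp: cand_def y2)
      then show ?thesis by (simp add: y2 val_upd_other)
    qed
    ultimately have "matched y2 s j" using best_subset[OF s(2) _ sub] by blast
    with s show ?thesis by blast
  next
    case False
    have sn: "s < num_arrivals G" using matched_arrival s by blast
    have "\<not> blocked y1 (k - 1) j s"
      using blocked_imp_not_available[of y1 s j] s sn matched_cand[OF s(2)] by (auto simp: cand_def)
    with False sn bl s(1) show ?thesis by (metis not_available_cases)
  qed
  have late: "arr_time G t \<le> arr_time G s + duration G"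
    if "s0 \<le> s" "t \<le> T" "s < num_arrivals G" for s t
    using arr_time_mono[of s0 s] arr_time_mono[of t T] that s0 T by simp
  have "cands y2 T \<subseteq> cands y1 T"
  proof (rule cands_mono[where k = k and i = i and T = T])
    show "y2 (k, i) = 1" "\<And>j. j \<noteq> i \<Longrightarrow> y1 (k, j) = y2 (k, j)" using y1 y2 by auto
    fix j t assume j: "j \<noteq> i" and t: "t \<le> T" "period G t = k" and "blocked y1 k j t"
    then obtain s where s: "period G s < k" "matched y1 s j"
        "arr_time G t \<le> arr_time G s + duration G"
      by (auto simp: blocked_def)
    show "blocked y2 k j t"
    proof (cases "s < s0")
      case True
      with s same show ?thesis by (auto simp: blocked_def)
    next
      case False
      have sn: "s < num_arrivals G" using matched_arrival s by blast
      have "period G s = k - 1" using period_mono[of s0 s] False sn s ps0 by simp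
      then obtain s' where s': "period G s' = k - 1" "matched y2 s' j" using prev s j by blast
      \<comment> \<open>Before \<open>s0\<close> the runs agree, so an earlier \<open>s'\<close>
        would give \<open>j\<close> two matches in one period of the first run.\<close>
      have "s0 \<le> s'"
      proof (rule ccontr)
        assume "\<not> s0 \<le> s'"
        then have "matched y1 s' j" "s' < s" using same s' False by auto
        then show False using matched_once_per_period[of y1 s' j s] s s' \<open>period G s = k - 1\<close> by auto
      qed
      then show ?thesis using s' late[of s' t] t matched_arrival[OF s'(2)]
        unfolding blocked_def by (intro exI[of _ s']) auto
    qed
  next
    \<comment> \<open>A block that exists only in the second run comes from a match not before
      \<open>s0\<close>, and so lasts through \<open>T\<close>.\<close>
    fix j s t assume st: "s \<le> t" "t \<le> T" and "blocked y2 k j s"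
    then obtain s' where s': "period G s' < k" "matched y2 s' j"
        "arr_time G s \<le> arr_time G s' + duration G"
      by (auto simp: blocked_def)
    show "blocked y1 k j s \<or> blocked y2 k j t"
    proof (cases "s' < s0")
      case True
      with s' same show ?thesis by (auto simp: blocked_def)
    next
      case False
      then show ?thesis using s' late[of s' t] st matched_arrival[OF s'(2)]
        unfolding blocked_def by (intro disjI2 exI[of _ s']) auto
    qed
  qed (use T in auto)
  moreover have "val y1 T j = val y2 T j" for j
    using T y2 by (simp add: val_def)
  ultimately show ?thesis by (intro lam_mono)
qed

lemma lam_eq_removed_if_unmatched:
  assumes "\<And>s. period G s = k \<Longrightarrow> \<not> matched y s i" "period G t \<noteq> k"
  shows "lam (y((k, i) := 1)) t = lam y t"
proof -
  have "run (y((k, i) := 1)) t = run y t" using assms by (intro run_remove)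
  moreover have "val (y((k, i) := 1)) t = val y t"
    using assms by (auto simp: val_upd_other)
  ultimately show ?thesis by (simp add: lam_def cand_def)
qed

section \<open>The gain of an edge\<close>

text \<open>The last term reads the seed of the preceding period because a match from an earlier
  period that still blocks at \<open>t\<close> must lie there.\<close>

definition edge_gain :: "'i \<Rightarrow> nat \<Rightarrow> (int \<times> 'i \<Rightarrow> real) \<Rightarrow> real" where
  "edge_gain i t y = lam y t
    + (if \<exists>s\<le>t. period G s = period G t \<and> matched y s i
       then reward G i * g \<beta> (y (period G t, i)) else 0)
    + (if blocked y (period G t) i t then reward G i * g \<beta> (y (period G t - 1, i)) else 0)"

text \<open>All seeds other than those of \<open>i\<close> in periods \<open>k - 1\<close> and
  \<open>k\<close> are fixed by \<open>y\<close>. The three cases for the match of \<open>i\<close>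
  in period \<open>k - 1\<close> (none, blocking at \<open>t\<close>, or earlier) supply the
  hypotheses of \<open>gain_calculus\<close>.\<close>

lemma edge_gain_integral:
  fixes y i t
  defines "k \<equiv> period G t" and "r \<equiv> reward G i"
  assumes \<beta>: "\<beta> \<le> 1" and \<alpha>: "0 \<le> \<alpha>" "\<alpha> \<le> 1 - g \<beta> 0"
    and \<alpha>_int: "ennreal \<alpha> \<le> (\<integral>\<^sup>+ x. ennreal (min (g \<beta> x) ((1 - g \<beta> 0) / \<beta>)) \<partial>unif01)"
    and edge: "(i, t) \<in> edges G" and r: "0 < reward G i"
  shows "ennreal (r * \<alpha>) \<le>
    (\<integral>\<^sup>+ x. \<integral>\<^sup>+ w. ennreal (edge_gain i t (y((k - 1, i) := x, (k, i) := w))) \<partial>unif01 \<partial>unif01)"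
proof -
  have t: "t < num_arrivals G" using edge edge_arrival by blast
  have r0: "0 < r" using r by (simp add: r_def)
  define Y where "Y x = y((k - 1, i) := x, (k, i) := 1)" for x
  have Y_alt: "Y x = (y((k, i) := 1))((k - 1, i) := x)" for x
    unfolding Y_def by (rule fun_upd_twist) simp
  define v where "v x = lam (Y x) t" for x
  \<comment> \<open>Normalized so that, with seed \<open>w\<close> in period \<open>k\<close>, the
    value of \<open>i\<close> for \<open>t\<close> exceeds \<open>v x\<close> exactly when
    \<open>g \<beta> w < U x\<close>.\<close>
  define U where "U x = 1 - v x / r" for x
  have vU: "v x = r * (1 - U x)" for x using r0 by (simp add: U_def)
  have U1: "U x \<le> 1" for x using lam_nonneg[of "Y x" t] r0 by (simp add: U_def v_def)
  define early where "early x \<longleftrightarrow> (\<exists>s. period G s = k - 1 \<and> matched (Y x) s i \<and>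
    arr_time G s + duration G < arr_time G t)" for x
  define \<phi> where "\<phi> x = (\<integral>\<^sup>+ w. ennreal (edge_gain i t (y((k - 1, i) := x, (k, i) := w))) \<partial>unif01)" for x
  have lam_ge: "v x \<le> lam (y((k - 1, i) := x, (k, i) := w)) t" for x w
    using lam_remove_le[OF t, of k "y((k - 1, i) := x, (k, i) := w)" i] unfolding v_def Y_def k_def by simp
  have blocked_iff: "blocked (y((k - 1, i) := x, (k, i) := w)) k i t \<longleftrightarrow> blocked (Y x) k i t" for x w
    unfolding Y_def by (rule blocked_cong) (simp only: matched_upd_later)
  \<comment> \<open>The payment to \<open>t\<close> and the share of the blocking match are bounded
    below independently of \<open>w\<close>.\<close>
  have phi_blocked: "ennreal (v x + r * g \<beta> x) \<le> \<phi> x" if "blocked (Y x) k i t" for x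
  proof -
    have "ennreal (v x + r * g \<beta> x) = (\<integral>\<^sup>+ w. ennreal (v x + r * g \<beta> x) \<partial>unif01)"
      by (simp only: nn_integral_unif01_const)
    also have "\<dots> \<le> \<phi> x" unfolding \<phi>_def
    proof (intro nn_integral_mono ennreal_leI)
      fix w
      show "v x + r * g \<beta> x \<le> edge_gain i t (y((k - 1, i) := x, (k, i) := w))"
        using lam_ge[of x w] blocked_iff[of x w] that mult_pos_pos[OF r g_pos[of \<beta> w]]
        unfolding edge_gain_def k_def[symmetric] r_def by auto
    qed
    finally show ?thesis .
  qed
  \<comment> \<open>Every \<open>w\<close> yields at least \<open>v x\<close>; those with
    \<open>g \<beta> w < U x\<close> force a match of \<open>i\<close> by \<open>t\<close> in period
    \<open>k\<close> and add \<open>r * g \<beta> w\<close>.\<close>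
  have phi_free: "ennreal (r * (1 - U x + max 0 ((U x - g \<beta> 0) / \<beta>))) \<le> \<phi> x"
    if nb: "\<not> blocked (Y x) k i t" for x
  proof -
    have "ennreal (r * (1 - U x + max 0 ((U x - g \<beta> 0) / \<beta>))) =
        ennreal (v x) + ennreal r * ennreal ((U x - g \<beta> 0) / \<beta>)"
    proof -
      define m where "m = max 0 ((U x - g \<beta> 0) / \<beta>)"
      have m: "0 \<le> m" "ennreal ((U x - g \<beta> 0) / \<beta>) = ennreal m"
        by (simp_all add: m_def)
      have "0 \<le> v x" unfolding v_def by (rule lam_nonneg)
      then have "ennreal (v x + r * m) = ennreal (v x) + ennreal r * ennreal m"
        using r0 m(1) by (simp add: ennreal_mult)
      then show ?thesis unfolding m(2) m_def[symmetric] distrib_left vU .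
    qed
    also have "\<dots> \<le> ennreal (v x) + ennreal r * (\<integral>\<^sup>+ w. ennreal (if g \<beta> w < U x then g \<beta> w else 0) \<partial>unif01)"
      by (intro add_left_mono mult_left_mono nn_integral_g_below beta_pos U1) simp
    also have "\<dots> = (\<integral>\<^sup>+ w. ennreal (v x) + ennreal r * ennreal (if g \<beta> w < U x then g \<beta> w else 0) \<partial>unif01)"
      by (simp add: nn_integral_add nn_integral_cmult nn_integral_unif01_const)
    also have "\<dots> \<le> \<phi> x" unfolding \<phi>_def
    proof (intro nn_integral_mono)
      fix w
      let ?y = "y((k - 1, i) := x, (k, i) := w)"
      have "v x + r * (if g \<beta> w < U x then g \<beta> w else 0) \<le> edge_gain i t ?y"
      proof (cases "g \<beta> w < U x")
        case True
        have "r * g \<beta> w < r * U x" using True r0 by (rule mult_strict_left_mono)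
        then have "v x < r * (1 - g \<beta> w)" by (simp add: vU right_diff_distrib)
        then have "lam (?y((k, i) := 1)) t < val ?y t i"
          by (simp add: val_def r_def k_def v_def Y_def)
        then have "\<exists>s\<le>t. period G s = k \<and> matched ?y s i"
          using blocked_iff[of x w] nb by (intro matched_if_val_large[OF t _ edge]) (simp_all add: k_def)
        then show ?thesis
          using lam_ge[of x w] blocked_iff[of x w] nb True r
          unfolding edge_gain_def k_def[symmetric] r_def by simp
      next
        case False
        then show ?thesis
          using lam_ge[of x w] blocked_iff[of x w] nb mult_pos_pos[OF r g_pos[of \<beta> w]]
          unfolding edge_gain_def k_def[symmetric] r_def by auto
      qed
      moreover have "0 \<le> v x" unfolding v_def by (rule lam_nonneg)
      ultimately show "ennreal (v x) + ennreal r * ennreal (if g \<beta> w < U x then g \<beta> w else 0)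
          \<le> ennreal (edge_gain i t ?y)"
        using r0 g_pos[of \<beta> w]
        by (simp add: ennreal_mult[symmetric] ennreal_plus[symmetric] ennreal_leI less_imp_le del: ennreal_plus)
    qed
    finally show ?thesis .
  qed
  have blockedE: "\<exists>s. period G s = k - 1 \<and> matched (Y x) s i \<and> arr_time G t \<le> arr_time G s + duration G"
    if bl: "blocked (Y x) k i t" for x
  proof -
    obtain s where s: "period G s < k" "matched (Y x) s i" "arr_time G t \<le> arr_time G s + duration G"
      using bl unfolding blocked_def by blast
    moreover have "period G s = k - 1" using blocks_next_period_only[OF s(3)] s(1) by (simp add: k_def)
    ultimately show ?thesis by blast
  qed
  have "ennreal (r * \<alpha>) \<le> (\<integral>\<^sup>+ x. \<phi> x \<partial>unif01)"
  \<comment> \<open>The threshold is \<open>U 1\<close>, because seed 1 also removes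
    \<open>i\<close> from period \<open>k - 1\<close>.\<close>
  proof (rule gain_calculus[OF beta_pos \<beta> \<alpha> \<alpha>_int U1[of 1], where early = early])
    show "0 \<le> r" using r0 by simp
  next
    fix x x' assume "early x" "x' < x"
    then obtain s where s: "period G s = k - 1" "matched (Y x) s i"
      "arr_time G s + duration G < arr_time G t" unfolding early_def by blast
    obtain s' where s': "s' \<le> s" "period G s' = k - 1" "matched (Y x') s' i"
      using matched_downward[OF s(2)[unfolded Y_alt] s(1) \<open>x' < x\<close>] unfolding Y_alt by blast
    have "arr_time G s' \<le> arr_time G s" using s' matched_arrival[OF s(2)] by (intro arr_time_mono)
    then show "early x'" unfolding early_def using s s' by (intro exI[of _ s']) auto
  next
    fix x assume "early x"
    then obtain s where s: "period G s = k - 1" "matched (Y x) s i"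
      "arr_time G s + duration G < arr_time G t" unfolding early_def by blast
    have "\<not> blocked (Y x) k i t"
    proof
      assume "blocked (Y x) k i t"
      then obtain s' where s': "period G s' = k - 1" "matched (Y x) s' i"
        "arr_time G t \<le> arr_time G s' + duration G" using blockedE by blast
      have "s = s'" using matched_once_per_period[OF s(2) s'(2)] s s' by simp
      then show False using s s' by simp
    qed
    from phi_free[OF this] show "ennreal (r * (1 - g \<beta> 0)) \<le> \<phi> x"
    proof (rule order_trans[rotated], intro ennreal_leI mult_left_mono)
      \<comment> \<open>Since \<beta> is at most 1, dividing by it does not decrease
        \<open>U x - g \<beta> 0\<close>. The bound holds for every threshold, so the dependence of
        \<open>U x\<close> on \<open>x\<close> is harmless here.\<close>
      show "1 - g \<beta> 0 \<le> 1 - U x + max 0 ((U x - g \<beta> 0) / \<beta>)"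
      proof (cases "U x \<le> g \<beta> 0")
        case False
        then have "U x - g \<beta> 0 \<le> (U x - g \<beta> 0) / \<beta>"
          using \<beta> beta_pos by (simp add: pos_le_divide_eq mult_left_le)
        then show ?thesis by simp
      qed simp
    qed (use r0 in simp)
  next
    fix x assume "\<not> early x"
    \<comment> \<open>Either \<open>i\<close> is blocked at \<open>t\<close> and the payment is no
      smaller than for the run without \<open>i\<close>, or \<open>i\<close> is unmatched in period
      \<open>k - 1\<close> and \<open>U x = U 1\<close>.\<close>
    show "ennreal (r * (1 - U 1 + min (g \<beta> x) (max 0 ((U 1 - g \<beta> 0) / \<beta>)))) \<le> \<phi> x"
    proof (cases "blocked (Y x) k i t")
      case True
      then obtain s0 where s0: "period G s0 = k - 1" "matched (Y x) s0 i"
        "arr_time G t \<le> arr_time G s0 + duration G" using blockedE by blast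
      have "v 1 \<le> v x"
        unfolding v_def
        by (rule lam_ge_removed_if_blocked[OF t, where k = k and i = i and ?s0.0 = s0])
          (use s0 in \<open>simp_all add: k_def Y_alt\<close>)
      then have "r * (1 - U 1 + min (g \<beta> x) (max 0 ((U 1 - g \<beta> 0) / \<beta>))) \<le> v x + r * g \<beta> x"
        using r0 by (simp add: vU distrib_left min.coboundedI1 add_mono)
      then show ?thesis using phi_blocked[OF True] ennreal_leI order_trans by blast
    next
      case False
      have "\<not> matched (Y x) s i" if "period G s = k - 1" for s
      proof
        assume m: "matched (Y x) s i"
        show False
        proof (cases "arr_time G t \<le> arr_time G s + duration G")
          case True
          then have "blocked (Y x) k i t" unfolding blocked_def using m that by (intro exI[of _ s]) auto
          then show False using False by blast
        next
          case False
          then show False using \<open>\<not> early x\<close> m that unfolding early_def by auto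
        qed
      qed
      then have "lam ((Y x)((k - 1, i) := 1)) t = lam (Y x) t"
        by (intro lam_eq_removed_if_unmatched) (auto simp: k_def)
      moreover have "(Y x)((k - 1, i) := 1) = Y 1" unfolding Y_alt by simp
      ultimately have "U x = U 1" unfolding U_def v_def by simp
      then have "ennreal (r * (1 - U 1 + max 0 ((U 1 - g \<beta> 0) / \<beta>))) \<le> \<phi> x"
        using phi_free[OF False] by simp
      then show ?thesis
        by (rule order_trans[rotated]) (use r0 in \<open>intro ennreal_leI mult_left_mono; simp\<close>)
    qed
  qed
  then show ?thesis unfolding \<phi>_def .
qed

section \<open>Sharing the reward of a run among the optimal edges\<close>

lemma run_subset: "run y t \<subseteq> resources G \<times> {..<t}"
  by (auto simp: mem_run best_def cand_def edge_resource)

lemma finite_run: "finite (run y t)"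
  using finite_subset[OF run_subset] finite_resources by blast

lemma sum_lam_eq_sum_val:
  "(\<Sum>s<n. lam y s) = (\<Sum>(i, s)\<in>run y n. val y s i)"
proof -
  have inj: "inj_on snd (run y n)"
    by (auto simp: inj_on_def mem_run intro: matched_unique)
  have "(\<Sum>(i, s)\<in>run y n. val y s i) = (\<Sum>p\<in>run y n. lam y (snd p))"
    by (intro sum.cong) (auto simp: mem_run lam_matched)
  also have "\<dots> = (\<Sum>s\<in>snd ` run y n. lam y s)"
    using inj by (simp add: sum.reindex)
  also have "\<dots> = (\<Sum>s<n. lam y s)"
  proof (intro sum.mono_neutral_left ballI)
    fix s assume s: "s \<in> {..<n} - snd ` run y n"
    show "lam y s = 0"
    proof (rule lam_unmatched)
      fix i
      have "(i, s) \<notin> run y n" using s by force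
      then show "\<not> matched y s i" using s by (simp add: mem_run)
    qed
  qed (auto simp: mem_run)
  finally show ?thesis by simp
qed

text \<open>The matches whose share \<open>r\<^sub>i g x\<close> is paid to the optimal edge \<open>(i, t)\<close>.\<close>

definition charged :: "(int \<times> 'i \<Rightarrow> real) \<Rightarrow> 'i \<times> nat \<Rightarrow> ('i \<times> nat) set" where
  "charged y = (\<lambda>(i, t). {(j, s). j = i \<and> matched y s i \<and>
    (s \<le> t \<and> period G s = period G t \<or>
     period G s < period G t \<and> arr_time G t \<le> arr_time G s + duration G)})"

text \<open>The two edges are more than \<open>d\<close> apart, hence in different periods. A match
  charged to both could reach \<open>t'\<close> only by blocking it, so it would come after
  \<open>t\<close>. But then it is too late to be charged to \<open>t\<close>.\<close>

lemma charged_disjoint: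
  assumes "arr_time G t + duration G < arr_time G t'" "t < t'" "t' < num_arrivals G"
  shows "charged y (i, t) \<inter> charged y (i, t') = {}"
proof -
  have False if st: "s \<le> t \<and> period G s = period G t \<or>
        period G s < period G t \<and> arr_time G t \<le> arr_time G s + duration G"
      and st': "s \<le> t' \<and> period G s = period G t' \<or>
        period G s < period G t' \<and> arr_time G t' \<le> arr_time G s + duration G"
      and s: "s < num_arrivals G" for s
  proof -
    have "period G t \<le> period G t'" using assms period_mono by simp
    moreover have "period G t \<noteq> period G t'" using same_period_close[of t t'] assms by auto
    ultimately have "period G s \<noteq> period G t'" using st by auto
    then have "arr_time G t < arr_time G s" using st' assms by auto
    then have "\<not> s \<le> t" using arr_time_mono[of s t] assms by auto
    then show False using st period_mono[of t s] s by auto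
  qed
  then show ?thesis unfolding charged_def by (auto dest: matched_arrival)
qed

lemma charged_subset: "charged y p \<subseteq> run y (num_arrivals G)"
  unfolding charged_def by (auto simp: mem_run dest: matched_arrival)

lemma edge_gain_le_charged:
  assumes "i \<in> resources G"
  shows "edge_gain i t y \<le> lam y t + (\<Sum>(j, s)\<in>charged y (i, t). reward G j * g \<beta> (y (period G s, j)))"
proof -
  let ?f = "\<lambda>(j, s). reward G j * g \<beta> (y (period G s, j))"
  let ?own = "\<exists>s\<le>t. period G s = period G t \<and> matched y s i"
  let ?A = "{(j, s). j = i \<and> matched y s i \<and> s \<le> t \<and> period G s = period G t}"
  let ?B = "{(j, s). j = i \<and> matched y s i \<and> period G s < period G t \<and> arr_time G t \<le> arr_time G s + duration G}"
  have f_nonneg: "0 \<le> reward G i * g \<beta> x" for x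
    using reward_nonneg[OF assms] g_pos[of \<beta> x] by simp
  have sub: "charged y (i, t) = ?A \<union> ?B" by (auto simp: charged_def)
  have fin: "finite ?A" "finite ?B"
    using finite_subset[OF charged_subset finite_run, of y "(i, t)"] unfolding sub by auto
  have "(if ?own then reward G i * g \<beta> (y (period G t, i)) else 0) \<le> sum ?f ?A"
  proof (cases ?own)
    case True
    then obtain s where s: "(i, s) \<in> ?A" by auto
    have "?f (i, s) \<le> sum ?f ?A"
      by (rule member_le_sum[OF s _ fin(1)]) (auto intro: f_nonneg)
    then show ?thesis using True s by auto
  next
    case False
    then show ?thesis by (auto intro!: sum_nonneg f_nonneg)
  qed
  moreover have "(if blocked y (period G t) i t then reward G i * g \<beta> (y (period G t - 1, i)) else 0) \<le> sum ?f ?B"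
  proof (cases "blocked y (period G t) i t")
    case True
    then obtain s where s: "(i, s) \<in> ?B" by (auto simp: blocked_def)
    then have "period G s = period G t - 1" using blocks_next_period_only[of t s] by auto
    moreover have "?f (i, s) \<le> sum ?f ?B"
      by (rule member_le_sum[OF s _ fin(2)]) (auto intro: f_nonneg)
    ultimately show ?thesis using True by auto
  next
    case False
    then show ?thesis by (auto intro!: sum_nonneg f_nonneg)
  qed
  moreover have "sum ?f (charged y (i, t)) = sum ?f ?A + sum ?f ?B"
    unfolding sub using fin by (intro sum.union_disjoint) auto
  ultimately show ?thesis unfolding edge_gain_def by linarith
qed

text \<open>Each match splits its reward into its value, paid to its arrival, and the rest, paid to
  an optimal edge. Optimal edges have distinct arrivals and disjoint charged sets, so nothing is
  paid twice.\<close>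

lemma sum_edge_gain_le_reward:
  assumes "feasible_matching G N"
  shows "(\<Sum>(i, t)\<in>N. edge_gain i t y) \<le> total_reward G (run y (num_arrivals G))"
proof -
  let ?n = "num_arrivals G"
  let ?f = "\<lambda>(j, s). reward G j * g \<beta> (y (period G s, j))"
  have N_edges: "N \<subseteq> edges G" using assms by (simp add: feasible_matching_def)
  then have "N \<subseteq> resources G \<times> {..<?n}" by (auto intro: edge_resource edge_arrival)
  then have fin: "finite N" using finite_subset finite_resources by blast
  have f_nonneg: "0 \<le> ?f p" if "p \<in> run y ?n" for p
    using that run_subset[of y ?n] reward_nonneg g_pos[of \<beta>]
    by (cases p) (auto intro!: mult_nonneg_nonneg intro: less_imp_le[OF g_pos])
  have "(\<Sum>(i, t)\<in>N. edge_gain i t y) \<le> (\<Sum>p\<in>N. lam y (snd p) + sum ?f (charged y p))"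
    using N_edges by (intro sum_mono) (auto intro!: edge_gain_le_charged edge_resource)
  also have "\<dots> = (\<Sum>p\<in>N. lam y (snd p)) + (\<Sum>p\<in>N. sum ?f (charged y p))"
    by (rule sum.distrib)
  also have "(\<Sum>p\<in>N. lam y (snd p)) = (\<Sum>t\<in>snd ` N. lam y t)"
  proof -
    have "i = j" if "(i, t) \<in> N" "(j, t) \<in> N" for i j t
      using assms that unfolding feasible_matching_def by blast
    then have "inj_on snd N" by (intro inj_onI) auto
    then show ?thesis by (simp add: sum.reindex)
  qed
  also have "\<dots> \<le> (\<Sum>t<?n. lam y t)"
    using \<open>N \<subseteq> resources G \<times> {..<?n}\<close> by (intro sum_mono2) (auto intro: lam_nonneg)
  also have "\<dots> = (\<Sum>(i, s)\<in>run y ?n. val y s i)" by (rule sum_lam_eq_sum_val)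
  also have "(\<Sum>p\<in>N. sum ?f (charged y p)) = sum ?f (\<Union>p\<in>N. charged y p)"
  proof (intro sum.UNION_disjoint[symmetric] fin ballI impI)
    show "finite (charged y p)" for p using finite_subset[OF charged_subset finite_run] .
    fix p q assume pq: "p \<in> N" "q \<in> N" "p \<noteq> q"
    obtain i t j t' where p: "p = (i, t)" and q: "q = (j, t')" by fastforce
    have n: "t < ?n" "t' < ?n" using pq N_edges edge_arrival unfolding p q by blast+
    show "charged y p \<inter> charged y q = {}"
    proof (cases "i = j")
      case True
      have gap: "arr_time G s + duration G < arr_time G s'"
        if "(i, s) \<in> N" "(i, s') \<in> N" "s < s'" for s s'
      proof -
        have "available G {(j, s). (j, s) \<in> N \<and> s < s'} s' i"
          using assms that(2) unfolding feasible_matching_def by blast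
        with that show ?thesis unfolding available_def by blast
      qed
      have "t \<noteq> t'" using pq p q True by auto
      then consider "t < t'" | "t' < t" by linarith
      then show ?thesis
      proof cases
        case 1
        have "arr_time G t + duration G < arr_time G t'" by (rule gap[OF _ _ 1]) (use pq p q True in simp_all)
        then show ?thesis unfolding p q True by (rule charged_disjoint[OF _ 1 n(2)])
      next
        case 2
        have "arr_time G t' + duration G < arr_time G t" by (rule gap[OF _ _ 2]) (use pq p q True in simp_all)
        then have "charged y (j, t') \<inter> charged y (j, t) = {}" by (rule charged_disjoint[OF _ 2 n(1)])
        then show ?thesis unfolding p q True by blast
      qed
    next
      case False
      then show ?thesis unfolding p q charged_def by auto
    qed
  qed
  also have "\<dots> \<le> sum ?f (run y ?n)"
    using charged_subset f_nonneg finite_run by (intro sum_mono2) blast+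
  also have "(\<Sum>(i, s)\<in>run y ?n. val y s i) + sum ?f (run y ?n) = total_reward G (run y ?n)"
    unfolding total_reward_def sum.distrib[symmetric]
    by (intro sum.cong) (auto simp: val_def algebra_simps)
  finally show ?thesis by simp
qed

section \<open>Measurability and comparison with Periodic Reranking\<close>

lemma measurable_seed:
  "i \<in> resources G \<Longrightarrow> (\<lambda>y. y (k, i)) \<in> borel_measurable (seeds G)"
  using measurable_component_singleton[of "(k, i)" "UNIV \<times> resources G" "\<lambda>_. unif01"]
  by (simp add: seeds_def cong: measurable_cong_sets)

lemma measurable_val:
  "i \<in> resources G \<Longrightarrow> (\<lambda>y. val y t i) \<in> borel_measurable (seeds G)"
  unfolding val_def using measurable_seed[of i "period G t"] by measurable

text \<open>Only finitely many histories \<open>M\<close> are possible. For a fixed one, the next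
  match is determined by finitely many comparisons of measurable values.\<close>

lemma measurable_run:
  "(\<lambda>y. run y t) \<in> measurable (seeds G) (count_space (Pow (resources G \<times> {..<t})))"
proof (induction t)
  case (Suc t)
  let ?I = "Pow (resources G \<times> {..<t})" and ?J = "Pow (resources G \<times> {..<Suc t})"
  let ?S = "\<lambda>M y. {i \<in> resources G. best (val y t) (cand y M t) i}"
  have fin: "finite ?I" using finite_resources by simp
  have S: "?S M \<in> measurable (seeds G) (count_space (Pow (resources G)))" for M
  proof (rule measurable_finite_Collect[OF finite_resources])
    fix i assume i: "i \<in> resources G"
    have "best (val y t) (cand y M t) i \<longleftrightarrow>
        ((i, t) \<in> edges G \<and> available G M t i) \<and> 0 < val y t i \<and>
        (\<forall>j\<in>resources G. ((j, t) \<in> edges G \<and> available G M t j) \<and> 0 < val y t j \<longrightarrow>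
          val y t j < val y t i \<or> (val y t j = val y t i \<and> rk i \<le> rk j))" for y
      unfolding best_def cand_def using edge_resource by blast
    moreover have "Measurable.pred (seeds G) (\<lambda>y. \<forall>j\<in>resources G.
        ((j, t) \<in> edges G \<and> available G M t j) \<and> 0 < val y t j \<longrightarrow>
          val y t j < val y t i \<or> (val y t j = val y t i \<and> rk i \<le> rk j))"
    proof (intro pred_intros_finite(3) finite_resources)
      fix j assume "j \<in> resources G"
      with i have [measurable]: "(\<lambda>y. val y t i) \<in> borel_measurable (seeds G)"
        "(\<lambda>y. val y t j) \<in> borel_measurable (seeds G)" by (simp_all add: measurable_val)
      show "Measurable.pred (seeds G) (\<lambda>y. ((j, t) \<in> edges G \<and> available G M t j) \<and> 0 < val y t j \<longrightarrow>
          val y t j < val y t i \<or> (val y t j = val y t i \<and> rk i \<le> rk j))"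
      proof -
        have pos: "Measurable.pred (seeds G) (\<lambda>y. 0 < val y t j)" by measurable
        have lt: "Measurable.pred (seeds G) (\<lambda>y. val y t j < val y t i)" by measurable
        have le: "Measurable.pred (seeds G) (\<lambda>y. val y t j \<le> val y t i)"
          unfolding pred_def by (rule borel_measurable_le) measurable
        show ?thesis
          using pred_intros_logic(4)[OF pos lt] pred_intros_logic(4)[OF pos le]
          by (cases "(j, t) \<in> edges G"; cases "available G M t j"; cases "rk i \<le> rk j")
            (simp_all add: le_less[symmetric])
      qed
    qed
    moreover have "Measurable.pred (seeds G) (\<lambda>y. 0 < val y t i)"
      using measurable_val[OF i, of t] by measurable
    ultimately show "Measurable.pred (seeds G) (\<lambda>y. best (val y t) (cand y M t) i)"
      by (simp only:) (intro pred_intros_logic(3) measurable_const; simp)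
  qed
  have "(\<lambda>y. M \<union> ?S M y \<times> {t}) \<in> measurable (seeds G) (count_space ?J)" if "M \<in> ?I" for M
    by (rule measurable_compose[OF S]) (use that in \<open>auto simp: measurable_count_space_eq1\<close>)
  then have "(\<lambda>y. run y t \<union> ?S (run y t) y \<times> {t}) \<in> measurable (seeds G) (count_space ?J)"
    using measurable_compose_countable'[OF _ Suc countable_finite[OF fin],
        of "\<lambda>M y. M \<union> ?S M y \<times> {t}"] by blast
  moreover have "?S (run y t) y = {i. matched y t i}" for y
    using cand_subset[of y "run y t" t] unfolding best_def by blast
  ultimately show ?case by (simp only: run.simps)
qed simp

lemma measurable_matched [measurable]: "Measurable.pred (seeds G) (\<lambda>y. matched y t i)"
proof -
  have "Measurable.pred (seeds G) (\<lambda>y. (i, t) \<in> run y (Suc t))"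
    by (rule measurable_compose[OF measurable_run]) simp
  then show ?thesis by (simp add: mem_run del: run.simps)
qed

lemma measurable_lam [measurable]: "(\<lambda>y. lam y t) \<in> borel_measurable (seeds G)"
proof -
  have "lam y t = (\<Sum>i\<in>resources G. if matched y t i then val y t i else 0)" for y
  proof (cases "\<exists>i. matched y t i")
    case True
    then obtain i where i: "matched y t i" by blast
    then have "i \<in> resources G" using matched_cand[OF i] cand_subset by blast
    have "matched y t j \<longleftrightarrow> j = i" for j using i matched_unique[OF i] by blast
    then have "(\<Sum>j\<in>resources G. if matched y t j then val y t j else 0) =
        (\<Sum>j\<in>resources G. if j = i then val y t j else 0)"
      by (simp only:)
    also have "\<dots> = lam y t"
      using \<open>i \<in> resources G\<close> finite_resources lam_matched[OF i] by simp
    finally show ?thesis by simp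
  next
    case False
    then show ?thesis by (simp add: lam_unmatched)
  qed
  then show ?thesis
    by (simp only:) (intro borel_measurable_sum measurable_If measurable_val measurable_matched; simp)
qed

lemma measurable_edge_gain [measurable]:
  assumes [simp]: "i \<in> resources G"
  shows "edge_gain i t \<in> borel_measurable (seeds G)"
proof -
  have [measurable]: "Measurable.pred (seeds G) (\<lambda>y. blocked y (period G t) i t)"
    unfolding blocked_def by measurable
  have [measurable]: "(\<lambda>y. y (period G t, i)) \<in> borel_measurable (seeds G)"
    "(\<lambda>y. y (period G t - 1, i)) \<in> borel_measurable (seeds G)"
    by (simp_all add: measurable_seed)
  show ?thesis unfolding edge_gain_def[abs_def] by measurable
qed

text \<open>Ties are excluded only when a positive reward is involved: worthless resources all have
  value 0 and tie for every seed.\<close>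

definition generic :: "(int \<times> 'i \<Rightarrow> real) \<Rightarrow> nat \<Rightarrow> bool" where
  "generic y t \<longleftrightarrow> (\<forall>i\<in>resources G. y (period G t, i) < 1) \<and>
    (\<forall>i\<in>resources G. \<forall>j\<in>resources G. i \<noteq> j \<longrightarrow> 0 < reward G i \<longrightarrow> val y t i \<noteq> val y t j)"

lemma seeds_resample:
  assumes "i \<in> resources G" "f \<in> borel_measurable (seeds G)"
  shows "(\<integral>\<^sup>+ y. f y \<partial>seeds G) = (\<integral>\<^sup>+ y. (\<integral>\<^sup>+ x. f (y((k, i) := x)) \<partial>unif01) \<partial>seeds G)"
    and "(\<lambda>y. \<integral>\<^sup>+ x. f (y((k, i) := x)) \<partial>unif01) \<in> borel_measurable (seeds G)"
  using nn_integral_PiM_resample[of "UNIV \<times> resources G" "\<lambda>_. unif01" "(k, i)" f]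
    prob_space_unif01 assms unfolding seeds_def by auto

lemma AE_seeds_resample:
  assumes "i \<in> resources G" "Measurable.pred (seeds G) P" "\<And>y. AE x in unif01. P (y((k, i) := x))"
  shows "AE y in seeds G. P y"
  using AE_PiM_resample[of "UNIV \<times> resources G" "\<lambda>_. unif01" "(k, i)" P]
    prob_space_unif01 assms unfolding seeds_def by auto

text \<open>With all other seeds fixed, the value of a resource of positive reward is injective in
  its own seed, so at most one seed produces a given tie.\<close>

lemma AE_generic: "AE y in seeds G. \<forall>t<num_arrivals G. generic y t"
proof -
  have "AE y in seeds G. y (period G t, i) < 1" if "i \<in> resources G" for t i
  proof (rule AE_seeds_resample[OF that])
    show "Measurable.pred (seeds G) (\<lambda>y. y (period G t, i) < 1)"
      using measurable_seed[OF that, of "period G t"] by measurable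
    show "AE x in unif01. (y((period G t, i) := x)) (period G t, i) < 1" for y
      using AE_unif01 by eventually_elim simp
  qed
  moreover have "AE y in seeds G. val y t i \<noteq> val y t j"
    if i: "i \<in> resources G" and j: "j \<in> resources G" and "i \<noteq> j" and r: "0 < reward G i" for t i j
  proof (rule AE_seeds_resample[OF i])
    show "Measurable.pred (seeds G) (\<lambda>y. val y t i \<noteq> val y t j)"
      unfolding pred_def using measurable_val[OF i, of t] measurable_val[OF j, of t]
      by (rule borel_measurable_neq)
    fix y :: "int \<times> 'i \<Rightarrow> real"
    let ?y = "\<lambda>x. y((period G t, i) := x)"
    have vj: "val (?y x) t j = val y t j" for x using \<open>i \<noteq> j\<close> by (simp add: val_upd_other)
    have vi: "val (?y x) t i = reward G i * (1 - g \<beta> x)" for x by (simp add: val_def)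
    show "AE x in unif01. val (?y x) t i \<noteq> val (?y x) t j"
    proof (cases "\<exists>x0. reward G i * (1 - g \<beta> x0) = val y t j")
      case True
      then obtain x0 where x0: "reward G i * (1 - g \<beta> x0) = val y t j" ..
      show ?thesis using AE_unif01_not_eq[of x0]
      proof eventually_elim
        case (elim x)
        then have "g \<beta> x \<noteq> g \<beta> x0"
          using g_strict_mono[OF beta_pos, of x x0] g_strict_mono[OF beta_pos, of x0 x] by force
        then show ?case unfolding vi vj x0[symmetric] using r by simp
      qed
    next
      case False
      then show ?thesis unfolding vi vj by simp
    qed
  qed
  ultimately show ?thesis
    unfolding generic_def using finite_resources
    by (auto simp: AE_all_countable AE_finite_all AE_conj_iff)
qed

section \<open>Periodic Reranking and its matches of positive reward\<close>

definition free :: "('i \<times> nat) set \<Rightarrow> nat \<Rightarrow> 'i set" where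
  "free M t = {i. (i, t) \<in> edges G \<and> available G M t i}"

definition maximizers :: "(int \<times> 'i \<Rightarrow> real) \<Rightarrow> nat \<Rightarrow> 'i set \<Rightarrow> 'i set" where
  "maximizers y t A = {i \<in> A. \<forall>j\<in>A. val y t j \<le> val y t i}"

lemma free_subset: "free M t \<subseteq> resources G"
  by (auto simp: free_def edge_resource)

lemma finite_free: "finite (free M t)"
  using finite_subset[OF free_subset finite_resources] .

lemma maximizers_nonempty:
  assumes "finite A" "A \<noteq> {}"
  shows "maximizers y t A \<noteq> {}"
proof -
  have "Max (val y t ` A) \<in> val y t ` A" using assms by (intro Max_in) auto
  then obtain i where "i \<in> A" "val y t i = Max (val y t ` A)" by force
  then have "i \<in> maximizers y t A" using assms(1) by (simp add: maximizers_def)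
  then show ?thesis by blast
qed

lemma periodic_reranking_Suc:
  "periodic_reranking \<beta> tie G y (Suc t) =
    (let M = periodic_reranking \<beta> tie G y t; A = free M t
     in if A = {} then M else insert (tie t (maximizers y t A), t) M)"
proof -
  have "{i. is_arg_max (\<lambda>i. reward G i * (1 - g \<beta> (y (period G t, i)))) (\<lambda>i. i \<in> A) i} = maximizers y t A"
    for A by (auto simp: maximizers_def is_arg_max_def val_def not_less)
  then show ?thesis by (simp only: periodic_reranking.simps Let_def free_def)
qed

text \<open>For generic seeds a free resource has positive value exactly if its reward is positive.
  So Periodic Reranking picks a worthless resource only if no other is free, and such a match does
  not affect the availability of the others. Otherwise the maximizer is unique and
  \<open>tie\<close> has no choice.\<close>

lemma run_eq_positive_part:
  assumes tie: "\<And>t S. S \<subseteq> resources G \<Longrightarrow> S \<noteq> {} \<Longrightarrow> tie t S \<in> S"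
    and gen: "\<And>t. t < n \<Longrightarrow> generic y t"
  shows "run y n = {(i, s) \<in> periodic_reranking \<beta> tie G y n. 0 < reward G i}"
  using gen
proof (induction n)
  case (Suc t)
  let ?P = "periodic_reranking \<beta> tie G y t"
  define A where "A = free ?P t"
  define S where "S = maximizers y t A"
  have S: "i \<in> S \<longleftrightarrow> i \<in> A \<and> (\<forall>j\<in>A. val y t j \<le> val y t i)" for i
    by (simp add: S_def maximizers_def)
  have P: "periodic_reranking \<beta> tie G y (Suc t) = (if A = {} then ?P else insert (tie t S, t) ?P)"
    by (simp only: periodic_reranking_Suc Let_def A_def S_def)
  have IH: "run y t = {(i, s) \<in> ?P. 0 < reward G i}" using Suc by simp
  have gen: "generic y t" using Suc.prems by simp
  have A_res: "A \<subseteq> resources G" unfolding A_def by (rule free_subset)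
  have val_pos_iff: "0 < val y t i \<longleftrightarrow> 0 < reward G i" if "i \<in> resources G" for i
  proof -
    have "g \<beta> (y (period G t, i)) < 1"
      using gen that g_strict_mono[OF beta_pos, of "y (period G t, i)" 1] by (simp add: generic_def g_one)
    then show ?thesis by (simp add: val_def zero_less_mult_iff)
  qed
  have C: "cands y t = {i \<in> A. 0 < reward G i}"
  proof -
    have "available G (run y t) t i \<longleftrightarrow> available G ?P t i" if "0 < reward G i" for i
      using that unfolding IH available_def by blast
    moreover have "0 < val y t i \<longleftrightarrow> 0 < reward G i" if "(i, t) \<in> edges G" for i
      using val_pos_iff edge_resource that by blast
    ultimately show ?thesis unfolding cand_def A_def free_def by blast
  qed
  have tie_S: "tie t S \<in> S" if "A \<noteq> {}"
  proof (rule tie)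
    show "S \<subseteq> resources G" using S A_res by blast
    show "S \<noteq> {}"
      using that maximizers_nonempty[OF finite_free] unfolding S_def A_def by blast
  qed
  have "{i. matched y t i} = (if A \<noteq> {} \<and> 0 < reward G (tie t S) then {tie t S} else {})"
  proof (cases "A \<noteq> {} \<and> 0 < reward G (tie t S)")
    case True
    let ?i = "tie t S"
    have i: "?i \<in> A" "\<And>j. j \<in> A \<Longrightarrow> val y t j \<le> val y t ?i" using tie_S True S[of ?i] by blast+
    have "val y t j < val y t ?i" if "j \<in> A" "j \<noteq> ?i" for j
    proof -
      have "val y t ?i \<noteq> val y t j"
      proof -
        have "?i \<in> resources G" "j \<in> resources G" using that i(1) A_res by blast+
        with gen True that(2) show ?thesis unfolding generic_def by metis
      qed
      then show ?thesis using i(2)[OF that(1)] by linarith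
    qed
    then have "matched y t ?i" using i(1) True unfolding C best_def by blast
    then have "{i. matched y t i} = {?i}" using matched_unique by blast
    then show ?thesis using True by simp
  next
    case False
    have "cands y t = {}"
    proof (rule ccontr)
      assume "cands y t \<noteq> {}"
      then obtain i where i: "i \<in> A" "0 < reward G i" unfolding C by blast
      then have *: "tie t S \<in> A" "val y t i \<le> val y t (tie t S)"
        using tie_S S[of "tie t S"] by blast+
      have "0 < val y t i" using val_pos_iff i A_res by blast
      then have "0 < reward G (tie t S)" using * val_pos_iff[of "tie t S"] A_res by auto
      then show False using False i by blast
    qed
    then have "\<not> matched y t i" for i using matched_cand[of y t i] by blast
    then have "{i. matched y t i} = {}" by blast
    with False show ?thesis by (simp only: if_False)
  qed
  then have "run y (Suc t) = run y t \<union> (if A \<noteq> {} \<and> 0 < reward G (tie t S) then {tie t S} else {}) \<times> {t}"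
    by (simp only: run.simps)
  also have "\<dots> = {(i, s) \<in> periodic_reranking \<beta> tie G y (Suc t). 0 < reward G i}"
    unfolding P IH by (cases "A = {}"; cases "0 < reward G (tie t S)") auto
  finally show ?case .
qed simp

lemma measurable_periodic_reranking:
  assumes tie: "\<And>t S. S \<subseteq> resources G \<Longrightarrow> S \<noteq> {} \<Longrightarrow> tie t S \<in> S"
  shows "(\<lambda>y. periodic_reranking \<beta> tie G y t)
    \<in> measurable (seeds G) (count_space (Pow (resources G \<times> {..<t})))"
proof (induction t)
  case (Suc t)
  let ?P = "\<lambda>y. periodic_reranking \<beta> tie G y t"
  let ?I = "Pow (resources G \<times> {..<t})" and ?J = "Pow (resources G \<times> {..<Suc t})"
  have fin: "finite ?I" using finite_resources by simp
  have S: "(\<lambda>y. maximizers y t (free M t)) \<in> measurable (seeds G) (count_space (Pow (free M t)))" for M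
    unfolding maximizers_def
  proof (rule measurable_finite_Collect[OF finite_free], intro pred_intros_finite(3) finite_free)
    fix i j assume "i \<in> free M t" "j \<in> free M t"
    then have "i \<in> resources G" "j \<in> resources G" using free_subset by blast+
    then show "Measurable.pred (seeds G) (\<lambda>y. val y t j \<le> val y t i)"
      unfolding pred_def by (intro borel_measurable_le measurable_val)
  qed
  \<comment> \<open>The set of maximizers is empty exactly if no resource is free, so it can serve
    as the test for leaving \<open>t\<close> unmatched. However arbitrary \<open>tie\<close> is, a
    function on a discrete space is measurable.\<close>
  define \<Phi> where "\<Phi> M S = (if S = {} then M else insert (tie t S, t) M)" for M S
  have "(\<lambda>y. \<Phi> M (maximizers y t (free M t))) \<in> measurable (seeds G) (count_space ?J)" if M: "M \<in> ?I" for M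
  proof (rule measurable_compose[OF S])
    have "\<Phi> M S \<in> ?J" if "S \<in> Pow (free M t)" for S
    proof (cases "S = {}")
      case False
      then have "tie t S \<in> resources G" using tie[of S t] that free_subset[of M t] by blast
      then show ?thesis using M False by (auto simp: \<Phi>_def)
    qed (use M in \<open>auto simp: \<Phi>_def\<close>)
    then show "\<Phi> M \<in> measurable (count_space (Pow (free M t))) (count_space ?J)"
      unfolding measurable_count_space_eq1 by simp
  qed
  then have "(\<lambda>y. \<Phi> (?P y) (maximizers y t (free (?P y) t))) \<in> measurable (seeds G) (count_space ?J)"
    using measurable_compose_countable'[OF _ Suc countable_finite[OF fin],
        of "\<lambda>M y. \<Phi> M (maximizers y t (free M t))"] by blast
  moreover have "\<Phi> M (maximizers y t (free M t)) =
      (if free M t = {} then M else insert (tie t (maximizers y t (free M t)), t) M)" for M y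
    using maximizers_nonempty[OF finite_free, of M t y t] by (auto simp: \<Phi>_def maximizers_def)
  ultimately show ?case by (simp only: periodic_reranking_Suc Let_def)
qed simp

section \<open>Expectations and the competitive ratio\<close>

lemma prob_space_seeds: "prob_space (seeds G)"
  unfolding seeds_def by (intro prob_space_PiM prob_space_unif01)

lemma expected_edge_gain:
  assumes \<beta>: "\<beta> \<le> 1" and \<alpha>: "0 \<le> \<alpha>" "\<alpha> \<le> 1 - g \<beta> 0"
    and \<alpha>_int: "ennreal \<alpha> \<le> (\<integral>\<^sup>+ x. ennreal (min (g \<beta> x) ((1 - g \<beta> 0) / \<beta>)) \<partial>unif01)"
    and edge: "(i, t) \<in> edges G"
  shows "ennreal (\<alpha> * reward G i) \<le> (\<integral>\<^sup>+ y. ennreal (edge_gain i t y) \<partial>seeds G)"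
proof (cases "reward G i = 0")
  case False
  have i: "i \<in> resources G" using edge edge_resource by blast
  then have r: "0 < reward G i" using False reward_nonneg by fastforce
  interpret prob_space "seeds G" by (rule prob_space_seeds)
  let ?k = "period G t"
  let ?h = "\<lambda>y. \<integral>\<^sup>+ w. ennreal (edge_gain i t (y((?k, i) := w))) \<partial>unif01"
  have meas: "(\<lambda>y. ennreal (edge_gain i t y)) \<in> borel_measurable (seeds G)" using i by measurable
  have "ennreal (\<alpha> * reward G i) = (\<integral>\<^sup>+ y. ennreal (\<alpha> * reward G i) \<partial>seeds G)"
    by (simp add: emeasure_space_1)
  also have "\<dots> \<le> (\<integral>\<^sup>+ y. \<integral>\<^sup>+ x. ?h (y((?k - 1, i) := x)) \<partial>unif01 \<partial>seeds G)"
    using edge_gain_integral[OF \<beta> \<alpha> \<alpha>_int edge r]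
    by (intro nn_integral_mono) (simp add: mult.commute)
  also have "\<dots> = (\<integral>\<^sup>+ y. ?h y \<partial>seeds G)"
    \<comment> \<open>The seed of period \<open>k - 1\<close> is integrated back first, then that of
      period \<open>k\<close>.\<close>
    by (rule seeds_resample(1)[OF i seeds_resample(2)[OF i meas], symmetric])
  also have "\<dots> = (\<integral>\<^sup>+ y. ennreal (edge_gain i t y) \<partial>seeds G)"
    by (rule seeds_resample(1)[OF i meas, symmetric])
  finally show ?thesis .
qed simp

lemma edge_gain_nonneg:
  assumes "i \<in> resources G" shows "0 \<le> edge_gain i t y"
  unfolding edge_gain_def using lam_nonneg[of y t] reward_nonneg[OF assms] less_imp_le[OF g_pos]
  by (auto intro!: add_nonneg_nonneg mult_nonneg_nonneg)

lemma nn_integral_total_reward_eq: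
  assumes tie: "\<And>t S. S \<subseteq> resources G \<Longrightarrow> S \<noteq> {} \<Longrightarrow> tie t S \<in> S"
  shows "(\<integral>\<^sup>+ y. ennreal (total_reward G (run y (num_arrivals G))) \<partial>seeds G) =
    ennreal (expected_reward \<beta> tie G)"
    and "0 \<le> expected_reward \<beta> tie G"
proof -
  let ?n = "num_arrivals G"
  let ?P = "\<lambda>y. periodic_reranking \<beta> tie G y ?n"
  interpret prob_space "seeds G" by (rule prob_space_seeds)
  have P_sub: "?P y \<subseteq> resources G \<times> {..<?n}" if "y \<in> space (seeds G)" for y
    using measurable_space[OF measurable_periodic_reranking[OF tie] that] by auto
  have fin: "finite (resources G \<times> {..<?n})" using finite_resources by simp
  have nonneg: "0 \<le> total_reward G X" "total_reward G X \<le> total_reward G (resources G \<times> {..<?n})"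
    if "X \<subseteq> resources G \<times> {..<?n}" for X
    unfolding total_reward_def using that fin reward_nonneg
    by (auto intro!: sum_nonneg sum_mono2)
  have meas: "(\<lambda>y. total_reward G (?P y)) \<in> borel_measurable (seeds G)"
    by (rule measurable_compose[OF measurable_periodic_reranking[OF tie]]) auto
  have "AE y in seeds G. total_reward G (run y ?n) = total_reward G (?P y)"
    using AE_generic AE_space
  proof eventually_elim
    case (elim y)
    have "total_reward G (run y ?n) = (\<Sum>(i, s)\<in>{(i, s) \<in> ?P y. 0 < reward G i}. reward G i)"
      unfolding total_reward_def using elim by (subst run_eq_positive_part[OF tie]) auto
    also have "\<dots> = total_reward G (?P y)"
      unfolding total_reward_def using P_sub[OF elim(2)] reward_nonneg
      by (intro sum.mono_neutral_left finite_subset[OF _ fin]) (fastforce simp: less_le)+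
    finally show ?case .
  qed
  then have "(\<integral>\<^sup>+ y. ennreal (total_reward G (run y ?n)) \<partial>seeds G) =
      (\<integral>\<^sup>+ y. ennreal (total_reward G (?P y)) \<partial>seeds G)"
    by (intro nn_integral_cong_AE) (auto elim: eventually_mono)
  also have "\<dots> = ennreal (expected_reward \<beta> tie G)"
    unfolding expected_reward_def
  proof (rule nn_integral_eq_integral)
    \<comment> \<open>The reward of all pairs is a uniform bound. Integrability matters because a
      Bochner integral is 0 by convention otherwise.\<close>
    show "integrable (seeds G) (\<lambda>y. total_reward G (?P y))"
      using nonneg P_sub
      by (intro integrable_const_bound[where B = "total_reward G (resources G \<times> {..<?n})"] meas AE_I2)
        (auto simp: abs_le_iff intro: order_trans)
    show "AE y in seeds G. 0 \<le> total_reward G (?P y)" using nonneg P_sub by (intro AE_I2) auto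
  qed
  finally show "(\<integral>\<^sup>+ y. ennreal (total_reward G (run y ?n)) \<partial>seeds G) =
      ennreal (expected_reward \<beta> tie G)" .
  show "0 \<le> expected_reward \<beta> tie G"
    unfolding expected_reward_def using nonneg P_sub by (intro integral_nonneg_AE AE_I2) auto
qed

lemma Offline_attained: "\<exists>N. feasible_matching G N \<and> Offline G = total_reward G N"
proof -
  have "{N. feasible_matching G N} \<subseteq> Pow (resources G \<times> {..<num_arrivals G})"
    by (auto simp: feasible_matching_def intro: edge_resource edge_arrival)
  then have "finite {N. feasible_matching G N}"
    by (rule finite_subset) (simp add: finite_resources)
  moreover have "feasible_matching G {}" by (simp add: feasible_matching_def)
  ultimately have "Offline G \<in> total_reward G ` {N. feasible_matching G N}"
    unfolding Offline_def by (intro Max_in) auto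
  then show ?thesis by blast
qed

text \<open>On average each edge of an optimal matching gains at least \<alpha> times its reward,
  while in every single run the gains sum to at most the reward of the run. Linearity combines the
  two.\<close>

theorem competitive:
  assumes tie: "\<And>t S. S \<subseteq> resources G \<Longrightarrow> S \<noteq> {} \<Longrightarrow> tie t S \<in> S"
    and \<beta>: "\<beta> \<le> 1" and \<alpha>: "0 \<le> \<alpha>" "\<alpha> \<le> 1 - g \<beta> 0"
    and \<alpha>_int: "ennreal \<alpha> \<le> (\<integral>\<^sup>+ x. ennreal (min (g \<beta> x) ((1 - g \<beta> 0) / \<beta>)) \<partial>unif01)"
  shows "\<alpha> * Offline G \<le> expected_reward \<beta> tie G"
proof -
  obtain N where N: "feasible_matching G N" "Offline G = total_reward G N"
    using Offline_attained by blast
  have N_edges: "N \<subseteq> edges G" using N by (simp add: feasible_matching_def)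
  have res: "i \<in> resources G" if "(i, t) \<in> N" for i t using that N_edges edge_resource by blast
  have "ennreal (\<alpha> * Offline G) = (\<Sum>(i, t)\<in>N. ennreal (\<alpha> * reward G i))"
    unfolding N(2) total_reward_def sum_distrib_left
    using \<alpha> res reward_nonneg by (subst sum_ennreal[symmetric]) (auto simp: case_prod_beta' intro!: sum.cong mult_nonneg_nonneg)
  also have "\<dots> \<le> (\<Sum>(i, t)\<in>N. \<integral>\<^sup>+ y. ennreal (edge_gain i t y) \<partial>seeds G)"
    using N_edges by (intro sum_mono) (auto intro!: expected_edge_gain[OF \<beta> \<alpha> \<alpha>_int])
  also have "\<dots> = (\<integral>\<^sup>+ y. (\<Sum>(i, t)\<in>N. ennreal (edge_gain i t y)) \<partial>seeds G)"
    unfolding case_prod_beta'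
  proof (rule nn_integral_sum[symmetric])
    fix p assume "p \<in> N"
    then have "fst p \<in> resources G" using res by (cases p) auto
    then show "(\<lambda>y. ennreal (edge_gain (fst p) (snd p) y)) \<in> borel_measurable (seeds G)" by measurable
  qed
  also have "\<dots> = (\<integral>\<^sup>+ y. ennreal (\<Sum>(i, t)\<in>N. edge_gain i t y) \<partial>seeds G)"
    using res edge_gain_nonneg
    by (intro nn_integral_cong, subst sum_ennreal[symmetric]) (auto simp: case_prod_beta' intro!: sum.cong)
  also have "\<dots> \<le> (\<integral>\<^sup>+ y. ennreal (total_reward G (run y (num_arrivals G))) \<partial>seeds G)"
    by (intro nn_integral_mono ennreal_leI sum_edge_gain_le_reward[OF N(1)])
  also have "\<dots> = ennreal (expected_reward \<beta> tie G)" by (rule nn_integral_total_reward_eq(1)[OF tie])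
  finally have "ennreal (\<alpha> * Offline G) \<le> ennreal (expected_reward \<beta> tie G)" .
  then show ?thesis using nn_integral_total_reward_eq(2)[OF tie] by (simp add: ennreal_le_iff)
qed

end

theorem theorem1:
  fixes G :: "'i omr" and tie :: "nat \<Rightarrow> 'i set \<Rightarrow> 'i"
  assumes "omr_instance G"
    and "\<And>t S. S \<subseteq> resources G \<Longrightarrow> S \<noteq> {} \<Longrightarrow> tie t S \<in> S"
  shows "expected_reward 0.89 tie G \<ge> 0.589 * Offline G"
proof -
  \<comment> \<open>Any injective numbering serves: \<open>rk\<close> breaks ties only in the
    auxiliary run, and \<open>tie\<close> stays arbitrary.\<close>
  obtain rk :: "'i \<Rightarrow> nat" where "inj_on rk (resources G)"
    using finite_imp_inj_to_nat_seg[of "resources G"] assms(1) unfolding omr_instance_def by blast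
  then interpret reranking G "0.89" rk
    using assms(1) by unfold_locales auto
  show ?thesis
    using g_0_89_bounds(1) by (intro competitive assms(2) ratio_integral_0_89) auto
qed

end
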